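(* Let $u$ be a local minimizer of $\mathcal J^\delta_\gamma$ in $B_1$ and let $z_0\in F(u)\cap B_{1/2}$. Assume $\delta_0:=\operatorname{ess\,inf}_{B_1}\delta>0$ and that $\gamma$ is continuous at $z_0$ with a modulus of continuity $\omega$ at $z_0$ satisfying, for a constant $\tilde C>0$, $$\omega(1)+\limsup_{t\to0^+}\ \omega(t)\ln\left(\frac1t\right)\le\tilde C.$$ Then there exist universal constants $r_0>0$ and $c^\ast>0$ such that $$\sup_{\partial B_r(z_0)}u\ \ge\ c^\ast\, r^{\frac{2}{2-\gamma(z_0)}}\qquad\text{for every }0<r<r_0.$$
   Context: $B_r(x)\subset\mathbb R^n$ is the open ball and $B_r=B_r(0)$. $\delta,\gamma:B_1\to[0,\infty)$ are bounded measurable functions; $\gamma_\ast(x,r)=\operatorname{ess\,inf}_{B_r(x)}\gamma$, $\gamma^\ast(x,r)=\operatorname{ess\,sup}_{B_r(x)}\gamma$, and $0<\gamma_\ast(0,1)\le\gamma^\ast(0,1)\le1$. For open $\mathcal O\subset B_1$, $$\mathcal J^\delta_\gamma(v,\mathcal O)=\int_{\mathcal O}\tfrac12|Dv|^2+\delta(x)(v^+)^{\gamma(x)}\,dx .$$ A local minimizer in $B_1$ is $u\in H^1(B_1)$ such that for every open $\mathcal O\subset B_1$, $\mathcal J^\delta_\gamma(u,\mathcal O)\le\mathcal J^\delta_\gamma(v,\mathcal O)$ for all $v\in H^1(\mathcal O)$ with $v-u\in H^1_0(\mathcal O)$. Minimizers are assumed normalized and non-negative: $0\le u\le1$ in $B_1$.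 $\Omega(u)=\{x\in B_1:u(x)>0\}$ and $F(u)=\partial\Omega(u)$ is the free boundary. That $\omega$ is a modulus of continuity at $z_0$ means $\omega$ is nondecreasing and $|\gamma(x)-\gamma(z_0)|\le\omega(|x-z_0|)$. "Universal" means depending only on the data $n$, $\delta_0$, $\|\delta\|_{L^\infty}$, $\gamma_\ast(0,1)$ and the modulus $\omega$ (including $\tilde C$), not on $u$ or $z_0$. *)

theory Defs
  imports "HOL-Analysis.Analysis" "HOL-Probability.Essential_Supremum"
begin

definition partial_deriv :: "'n::finite \<Rightarrow> (real ^ 'n \<Rightarrow> real) \<Rightarrow> real ^ 'n \<Rightarrow> real" where
  "partial_deriv i f x = frechet_derivative f (at x) (axis i 1)"

text \<open>\<open>Ck k f\<close>: \<open>f\<close> is of class \<open>C^k\<close> on the whole space.\<close>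

primrec Ck :: "nat \<Rightarrow> (real ^ 'n::finite \<Rightarrow> real) \<Rightarrow> bool" where
  "Ck 0 f \<longleftrightarrow> continuous_on UNIV f"
| "Ck (Suc k) f \<longleftrightarrow> f differentiable_on UNIV \<and> (\<forall>i. Ck k (partial_deriv i f))"

text \<open>\<open>C\<^sub>c^\<infinity>(U)\<close>, its elements being extended by zero to the whole space.\<close>

definition test_functions :: "(real ^ 'n::finite) set \<Rightarrow> (real ^ 'n \<Rightarrow> real) set" where
  "test_functions U =
     {\<phi>. (\<forall>k. Ck k \<phi>) \<and> compact (closure {x. \<phi> x \<noteq> 0}) \<and> closure {x. \<phi> x \<noteq> 0} \<subseteq> U}"

definition square_integrable_on ::
  "(real ^ 'n::finite) set \<Rightarrow> (real ^ 'n \<Rightarrow> 'b::euclidean_space) \<Rightarrow> bool" where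
  "square_integrable_on U f \<longleftrightarrow>
     f \<in> borel_measurable (lebesgue_on U) \<and> integrable (lebesgue_on U) (\<lambda>x. (norm (f x))\<^sup>2)"

text \<open>\<open>u\<close> and its weak gradient \<open>G\<close> are both required to lie in \<open>L\<^sup>2(U)\<close>, so the two
  integrals below are always integrals of integrable functions.\<close>

definition has_weak_gradient ::
  "(real ^ 'n::finite) set \<Rightarrow> (real ^ 'n \<Rightarrow> real) \<Rightarrow> (real ^ 'n \<Rightarrow> real ^ 'n) \<Rightarrow> bool" where
  "has_weak_gradient U u G \<longleftrightarrow>
     square_integrable_on U u \<and> square_integrable_on U G \<and>
     (\<forall>\<phi>\<in>test_functions U. \<forall>i.
        integral\<^sup>L (lebesgue_on U) (\<lambda>x. u x * partial_deriv i \<phi> x) =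
        - integral\<^sup>L (lebesgue_on U) (\<lambda>x. G x $ i * \<phi> x))"

definition H1 :: "(real ^ 'n::finite) set \<Rightarrow> (real ^ 'n \<Rightarrow> real) set" where
  "H1 U = {u. \<exists>G. has_weak_gradient U u G}"

text \<open>For open \<open>U\<close> the weak gradient is unique up to null sets, so the choice is immaterial
  under integrals. Only used for \<open>u \<in> H1 U\<close>.\<close>

definition weak_gradient ::
  "(real ^ 'n::finite) set \<Rightarrow> (real ^ 'n \<Rightarrow> real) \<Rightarrow> real ^ 'n \<Rightarrow> real ^ 'n" where
  "weak_gradient U u = (SOME G. has_weak_gradient U u G)"

definition H1_norm :: "(real ^ 'n::finite) set \<Rightarrow> (real ^ 'n \<Rightarrow> real) \<Rightarrow> real" where
  "H1_norm U u =
     sqrt (integral\<^sup>L (lebesgue_on U) (\<lambda>x. (u x)\<^sup>2 + (norm (weak_gradient U u x))\<^sup>2))"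

text \<open>The closure of \<open>C\<^sub>c^\<infinity>(U)\<close> in \<open>H1 U\<close>.\<close>

definition H10 :: "(real ^ 'n::finite) set \<Rightarrow> (real ^ 'n \<Rightarrow> real) set" where
  "H10 U = {u \<in> H1 U. \<exists>\<phi>. (\<forall>k::nat. \<phi> k \<in> test_functions U) \<and>
                       (\<lambda>k. H1_norm U (\<lambda>x. \<phi> k x - u x)) \<longlonglongrightarrow> 0}"

definition essinf :: "'a measure \<Rightarrow> ('a \<Rightarrow> ereal) \<Rightarrow> ereal" where
  "essinf M f = - esssup M (\<lambda>x. - f x)"

definition ess_lower :: "(real ^ 'n::finite \<Rightarrow> real) \<Rightarrow> real ^ 'n \<Rightarrow> real \<Rightarrow> ereal" where
  "ess_lower \<gamma> x r = essinf (lebesgue_on (ball x r)) (\<lambda>y. ereal (\<gamma> y))"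

definition ess_upper :: "(real ^ 'n::finite \<Rightarrow> real) \<Rightarrow> real ^ 'n \<Rightarrow> real \<Rightarrow> ereal" where
  "ess_upper \<gamma> x r = esssup (lebesgue_on (ball x r)) (\<lambda>y. ereal (\<gamma> y))"

definition bounded_measurable_nonneg :: "(real ^ 'n::finite \<Rightarrow> real) \<Rightarrow> bool" where
  "bounded_measurable_nonneg f \<longleftrightarrow>
     f \<in> borel_measurable (lebesgue_on (ball 0 1)) \<and>
     bounded (f ` ball 0 1) \<and> (\<forall>x\<in>ball 0 1. 0 \<le> f x)"

definition J_functional ::
  "(real ^ 'n::finite \<Rightarrow> real) \<Rightarrow> (real ^ 'n \<Rightarrow> real) \<Rightarrow> (real ^ 'n \<Rightarrow> real) \<Rightarrow> (real ^ 'n) set \<Rightarrow> real"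
  where
  "J_functional \<delta> \<gamma> v U =
     integral\<^sup>L (lebesgue_on U)
       (\<lambda>x. 1 / 2 * (norm (weak_gradient U v x))\<^sup>2 + \<delta> x * (max (v x) 0) powr \<gamma> x)"

definition local_minimizer ::
  "(real ^ 'n::finite \<Rightarrow> real) \<Rightarrow> (real ^ 'n \<Rightarrow> real) \<Rightarrow> (real ^ 'n \<Rightarrow> real) \<Rightarrow> bool" where
  "local_minimizer \<delta> \<gamma> u \<longleftrightarrow>
     u \<in> H1 (ball 0 1) \<and>
     (\<forall>U. open U \<and> U \<subseteq> ball 0 1 \<longrightarrow>
        (\<forall>v\<in>H1 U. (\<lambda>x. v x - u x) \<in> H10 U \<longrightarrow>
           J_functional \<delta> \<gamma> u U \<le> J_functional \<delta> \<gamma> v U))"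

text \<open>Minimizers are normalized and non-negative. Elements of \<open>H1\<close> are functions here, not
  classes modulo null sets, whereas the free boundary and suprema over spheres see pointwise
  values; \<open>u\<close> is therefore taken to be the continuous representative.\<close>

definition normalized_minimizer ::
  "(real ^ 'n::finite \<Rightarrow> real) \<Rightarrow> (real ^ 'n \<Rightarrow> real) \<Rightarrow> (real ^ 'n \<Rightarrow> real) \<Rightarrow> bool" where
  "normalized_minimizer \<delta> \<gamma> u \<longleftrightarrow>
     local_minimizer \<delta> \<gamma> u \<and> continuous_on (ball 0 1) u \<and> (\<forall>x\<in>ball 0 1. 0 \<le> u x \<and> u x \<le> 1)"

definition positivity_set :: "(real ^ 'n::finite \<Rightarrow> real) \<Rightarrow> (real ^ 'n) set" where
  "positivity_set u = {x \<in> ball 0 1. u x > 0}"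

definition free_boundary :: "(real ^ 'n::finite \<Rightarrow> real) \<Rightarrow> (real ^ 'n) set" where
  "free_boundary u = frontier (positivity_set u)"

definition modulus_at ::
  "(real \<Rightarrow> real) \<Rightarrow> (real ^ 'n::finite \<Rightarrow> real) \<Rightarrow> real ^ 'n \<Rightarrow> bool" where
  "modulus_at \<omega> \<gamma> z \<longleftrightarrow>
     mono_on {0..} \<omega> \<and> (\<forall>x\<in>ball 0 1. \<bar>\<gamma> x - \<gamma> z\<bar> \<le> \<omega> (norm (x - z)))"

end

theory Submission
  imports Defs
begin

text \<open>Comparing \<open>u\<close> with \<open>u - t \<phi>\<close> for a nonnegative test function \<open>\<phi>\<close> supported in
  \<open>{u > 0}\<close>, concavity of \<open>s \<mapsto> s powr \<gamma>\<close> gives \<open>\<Delta>u \<ge> \<delta> \<gamma> u powr (\<gamma> - 1)\<close> in the sense of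
  distributions there. Let \<open>M\<close> be the maximum of \<open>u\<close> on the sphere of radius \<open>r\<close> about \<open>z\<^sub>0\<close>, and suppose
  that \<open>M\<close> is much smaller than \<open>r powr (2 / (2 - \<gamma> z\<^sub>0))\<close>. Comparison with the constant \<open>M\<close> gives
  \<open>u \<le> M\<close> in the ball, so \<open>\<Delta>u\<close> is there at least of order \<open>M powr (\<gamma> z\<^sub>0 - 1)\<close>, the oscillation
  of the exponent costing only a bounded factor because of the logarithmic modulus of continuity.
  This exceeds the Laplacian of \<open>h x = 4 M |x - y|\<^sup>2 / r\<^sup>2\<close>, which dominates \<open>u\<close> on the sphere whenever
  \<open>|y - z\<^sub>0| \<le> r / 2\<close>. Hence \<open>u y \<le> h y = 0\<close> for all \<open>y\<close> near \<open>z\<^sub>0\<close>, so \<open>z\<^sub>0\<close> is not a free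
  boundary point.\<close>

subsection \<open>Smooth functions\<close>

text \<open>No lower bound for \<open>M\<close> is available, so the loss from the oscillating
  exponent cannot be measured in powers of \<open>M\<close> itself. With \<open>g\<close> the
  exponent at \<open>z\<^sub>0\<close> and \<open>w\<close> the modulus at radius \<open>r\<close>,
  the comparison comes down to \<open>M powr (g - 2 + w)\<close> against \<open>r powr (-2)\<close>.
  That exponent of \<open>M\<close> is negative, so \<open>M\<close> may be replaced by its assumed
  upper bound, a multiple of a power of \<open>r\<close>, and the logarithmic condition is spent on
  \<open>r\<close> alone. It also forces \<open>w \<le> 1 / 2\<close> for small \<open>r\<close>,
  which keeps the exponent at most \<open>- 1 / 2\<close>; hence the square root of the constant in
  the smallness condition. The comparison with the constant \<open>M\<close> uses only
  \<open>u \<le> 1\<close>, which already gives the Laplacian the positive lower bound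
  \<open>\<delta>\<^sub>0 * \<gamma>\<^sub>0\<close>. The minimizer has only a weak gradient, and
  the differential inequality is available only inside \<open>{u > 0}\<close>. A nonnegative barrier
  \<open>h\<close> places \<open>{u > h}\<close> there, and mollifying \<open>u - h\<close> reduces
  the comparison to a second derivative test in which only smooth kernels act as test
  functions.\<close>

lemma partial_deriv_eq:
  assumes "(f has_derivative D) (at x)"
  shows "partial_deriv i f x = D (axis i 1)"
  using frechet_derivative_at[OF assms] unfolding partial_deriv_def by simp

lemma Ck_Suc_imp_Ck: "Ck (Suc k) f \<Longrightarrow> Ck k f"
proof (induction k arbitrary: f)
  case 0
  then show ?case by (simp add: differentiable_imp_continuous_on)
next
  case (Suc k)
  then show ?case by auto
qed

lemma Ck_const: "Ck k (\<lambda>x :: real ^ 'n::finite. c)"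
proof (induction k arbitrary: c)
  case (Suc k)
  have "partial_deriv i (\<lambda>x :: real ^ 'n. c) = (\<lambda>x. 0)" for i
    by (rule ext) (simp add: partial_deriv_def)
  with Suc show ?case by (simp add: differentiable_on_def)
qed (simp add: continuous_on_const)

lemma partial_deriv_combine:
  fixes f g :: "real ^ 'n::finite \<Rightarrow> real"
  assumes "f differentiable_on UNIV" "g differentiable_on UNIV"
  shows "partial_deriv i (\<lambda>x. f x + g x) = (\<lambda>x. partial_deriv i f x + partial_deriv i g x)"
    and "partial_deriv i (\<lambda>x. f x * g x) = (\<lambda>x. f x * partial_deriv i g x + partial_deriv i f x * g x)"
proof -
  have d: "(f has_derivative frechet_derivative f (at x)) (at x)"
    "(g has_derivative frechet_derivative g (at x)) (at x)" for x
    using assms by (auto simp: differentiable_on_def frechet_derivative_works)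
  show "partial_deriv i (\<lambda>x. f x + g x) = (\<lambda>x. partial_deriv i f x + partial_deriv i g x)"
  proof
    fix x
    show "partial_deriv i (\<lambda>x. f x + g x) x = partial_deriv i f x + partial_deriv i g x"
      by (subst partial_deriv_eq[OF has_derivative_add[OF d(1) d(2)]]) (simp add: partial_deriv_def)
  qed
  show "partial_deriv i (\<lambda>x. f x * g x) = (\<lambda>x. f x * partial_deriv i g x + partial_deriv i f x * g x)"
  proof
    fix x
    show "partial_deriv i (\<lambda>x. f x * g x) x = f x * partial_deriv i g x + partial_deriv i f x * g x"
      by (subst partial_deriv_eq[OF has_derivative_mult[OF d(1) d(2)]]) (simp add: partial_deriv_def)
  qed
qed

lemma Ck_add: "Ck k f \<Longrightarrow> Ck k g \<Longrightarrow> Ck k (\<lambda>x. f x + g x)"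
proof (induction k arbitrary: f g)
  case (Suc k)
  then show ?case by (auto simp: partial_deriv_combine differentiable_on_add)
qed (simp add: continuous_on_add)

lemma Ck_mult: "Ck k f \<Longrightarrow> Ck k g \<Longrightarrow> Ck k (\<lambda>x. f x * g x)"
proof (induction k arbitrary: f g)
  case (Suc k)
  have "Ck k f" "Ck k g"
    using Suc.prems by (blast intro: Ck_Suc_imp_Ck)+
  with Suc show ?case by (auto simp: partial_deriv_combine intro!: Ck_add)
qed (simp add: continuous_on_mult)

lemma Ck_sum: "finite I \<Longrightarrow> (\<And>i. i \<in> I \<Longrightarrow> Ck k (f i)) \<Longrightarrow> Ck k (\<lambda>x. \<Sum>i\<in>I. f i x)"
  by (induction I rule: finite_induct) (auto intro: Ck_const Ck_add)

lemma Ck_prod: "finite I \<Longrightarrow> (\<And>i. i \<in> I \<Longrightarrow> Ck k (f i)) \<Longrightarrow> Ck k (\<lambda>x. \<Prod>i\<in>I. f i x)"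
  by (induction I rule: finite_induct) (auto intro: Ck_const Ck_mult)

lemma Ck_component: "Ck k (\<lambda>x :: real ^ 'n::finite. x $ i)"
proof (cases k)
  case (Suc l)
  have d: "((\<lambda>x. x $ i) has_derivative (\<lambda>v. v $ i)) (at x)" for x :: "real ^ 'n"
    by (rule bounded_linear_imp_has_derivative[OF bounded_linear_vec_nth])
  have "partial_deriv j (\<lambda>x :: real ^ 'n. x $ i) = (\<lambda>x. axis j 1 $ i)" for j
    by (rule ext) (simp add: partial_deriv_eq[OF d])
  with d Suc show ?thesis
    by (auto simp: Ck_const differentiable_on_def differentiable_def)
qed (simp add: continuous_on_component)

lemma Ck_dist_sq: "Ck k (\<lambda>x :: real ^ 'n::finite. (norm (x - z))\<^sup>2)"
proof -
  have "(\<lambda>x :: real ^ 'n. (norm (x - z))\<^sup>2) = (\<lambda>x. \<Sum>i\<in>UNIV. (x $ i + - (z $ i)) * (x $ i + - (z $ i)))"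
    unfolding power2_norm_eq_inner inner_vec_def by simp
  moreover have "Ck k \<dots>"
    by (intro Ck_sum Ck_mult Ck_add Ck_component Ck_const) simp
  ultimately show ?thesis by simp
qed

section \<open>Smooth cutoffs built from the flat exponential\<close>

definition flat :: "nat \<Rightarrow> real \<Rightarrow> real" where
  "flat m t = (if t \<le> 0 then 0 else exp (- (1 / t)) / t ^ m)"

lemma flat_at_right_0: "(flat m \<longlongrightarrow> 0) (at_right 0)"
proof -
  have "((\<lambda>t. inverse t ^ m / exp (inverse t)) \<longlongrightarrow> (0::real)) (at_right 0)"
    by (rule filterlim_compose[OF tendsto_power_div_exp_0 filterlim_inverse_at_top_right])
  moreover have "\<forall>\<^sub>F t in at_right 0. inverse t ^ m / exp (inverse t) = flat m t"
    by (rule eventually_mono[OF eventually_at_right_less]) (simp add: flat_def exp_minus field_simps)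
  ultimately show ?thesis by (rule Lim_transform_eventually)
qed

text \<open>Dividing the classical function exp(-1/t) by powers of t gives a family whose
  derivatives are again combinations of its members; this is why \<open>flat\<close> carries the
  index \<open>m\<close>.\<close>

lemma flat_has_derivative:
  "(flat m has_real_derivative (flat (m + 2) t - real m * flat (m + 1) t)) (at t)"
proof -
  consider "t < 0" | "t = 0" | "t > 0" by linarith
  then show ?thesis
  proof cases
    case 1
    have "((\<lambda>_. 0) has_real_derivative 0) (at t)" by simp
    then have "(flat m has_real_derivative 0) (at t)"
      by (rule has_field_derivative_transform_within_open[where S = "{..<0}"])
        (use 1 in \<open>auto simp: flat_def\<close>)
    with 1 show ?thesis by (simp add: flat_def)
  next
    case 2
    \<comment> \<open>To the right of the origin the difference quotient is exactly
      \<open>flat (m + 1)\<close>, which tends to 0.\<close>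
    have r: "((\<lambda>h. (flat m (0 + h) - flat m 0) / h) \<longlongrightarrow> 0) (at_right 0)"
      by (rule Lim_transform_eventually[OF flat_at_right_0[of "m + 1"]])
        (rule eventually_mono[OF eventually_at_right_less], simp add: flat_def field_simps)
    have l: "((\<lambda>h. (flat m (0 + h) - flat m 0) / h) \<longlongrightarrow> 0) (at_left 0)"
      by (rule Lim_transform_eventually[OF tendsto_const])
        (auto simp: flat_def eventually_at_left_field intro!: exI[of _ "-1"])
    from l r have "((\<lambda>h. (flat m (0 + h) - flat m 0) / h) \<longlongrightarrow> 0) (at 0)"
      by (simp add: filterlim_split_at)
    with 2 show ?thesis by (simp add: DERIV_def flat_def)
  next
    case 3
    have "((\<lambda>t. exp (- (1 / t)) / t ^ m) has_real_derivative
        (exp (- (1 / t)) * (1 / (t * t)) * t ^ m - exp (- (1 / t)) * (real m * t ^ (m - 1))) / (t ^ m * t ^ m)) (at t)"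
      using 3 by (auto intro!: derivative_eq_intros)
    also have "(exp (- (1 / t)) * (1 / (t * t)) * t ^ m - exp (- (1 / t)) * (real m * t ^ (m - 1))) / (t ^ m * t ^ m) =
        flat (m + 2) t - real m * flat (m + 1) t"
      using 3 by (cases m) (simp_all add: flat_def divide_simps, simp_all add: algebra_simps)
    finally have "((\<lambda>t. exp (- (1 / t)) / t ^ m) has_real_derivative
        (flat (m + 2) t - real m * flat (m + 1) t)) (at t)" .
    then show ?thesis
      by (rule has_field_derivative_transform_within_open[where S = "{0<..}"])
        (use 3 in \<open>auto simp: flat_def\<close>)
  qed
qed

text \<open>Induction on the order of smoothness with \<open>m\<close> arbitrary: by the chain rule
  a partial derivative is a combination of two other \<open>flat\<close> compositions times a
  derivative of \<open>q\<close>.\<close>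

lemma Ck_flat:
  fixes q :: "real ^ 'n::finite \<Rightarrow> real"
  assumes q: "\<And>k. Ck k q"
  shows "Ck k (\<lambda>x. flat m (q x))"
proof (induction k arbitrary: m)
  case 0
  have "continuous_on UNIV (flat m)"
    by (rule DERIV_continuous_on) (rule DERIV_subset[OF flat_has_derivative subset_UNIV])
  from continuous_on_compose2[OF this, of UNIV q] show ?case
    using q[of 0] by simp
next
  case (Suc k)
  have qd: "(q has_derivative frechet_derivative q (at x)) (at x)" for x
    using q[of "Suc 0"] frechet_derivative_works[of q "at x"] by (simp add: differentiable_on_def)
  have d: "((\<lambda>x. flat m (q x)) has_derivative
      (\<lambda>v. (flat (m + 2) (q x) - real m * flat (m + 1) (q x)) * frechet_derivative q (at x) v)) (at x)" for x
    by (rule has_derivative_compose[OF qd flat_has_derivative[of m "q x", unfolded has_field_derivative_def]])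
  have "partial_deriv i (\<lambda>x. flat m (q x)) =
      (\<lambda>x. (flat (m + 2) (q x) + - real m * flat (m + 1) (q x)) * partial_deriv i q x)" for i
    by (rule ext, subst partial_deriv_eq[OF d]) (simp add: partial_deriv_def)
  moreover have "Ck k (partial_deriv i q)" for i
    using q[of "Suc k"] by simp
  then have "Ck k (\<lambda>x. (flat (m + 2) (q x) + - real m * flat (m + 1) (q x)) * partial_deriv i q x)" for i
    by (intro Ck_mult Ck_add Ck_const Suc.IH)
  moreover have "(\<lambda>x. flat m (q x)) differentiable_on UNIV"
    using differentiableI[OF d] by (simp add: differentiable_on_def)
  ultimately show ?case by (simp only: Ck.simps simp_thms)
qed

lemma flat_0_le_1: "0 \<le> flat 0 t" "flat 0 t \<le> 1"
  by (auto simp: flat_def)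

lemma flat_0_scaled_tendsto:
  assumes "filterlim f at_top sequentially"
  shows "(\<lambda>k. flat 0 (f k)) \<longlonglongrightarrow> 1"
proof -
  have "(\<lambda>k. exp (- (inverse (f k)))) \<longlonglongrightarrow> exp (- 0)"
    by (intro tendsto_intros filterlim_compose[OF tendsto_inverse_0_at_top assms] filterlim_ident)
  moreover have "\<forall>\<^sub>F k in sequentially. exp (- (inverse (f k))) = flat 0 (f k)"
    using filterlim_at_top_dense[THEN iffD1, OF assms, rule_format, of 0]
    by (rule eventually_mono) (simp add: flat_def field_simps)
  ultimately show ?thesis by (auto intro: Lim_transform_eventually)
qed

text \<open>The standard mollifying kernel, left unnormalized. Squared lengths keep the argument of
  \<open>flat\<close> polynomial, hence smooth at the centre too.\<close>

definition bump :: "real \<Rightarrow> real ^ 'n::finite \<Rightarrow> real ^ 'n \<Rightarrow> real" where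
  "bump s z x = flat 0 (s\<^sup>2 - (norm (x - z))\<^sup>2)"

lemma Ck_bump: "Ck k (bump s z)"
proof -
  have "Ck k (\<lambda>x. s\<^sup>2 + (-1) * (norm (x - z))\<^sup>2)" for k
    by (intro Ck_add Ck_mult Ck_const Ck_dist_sq)
  from Ck_flat[OF this, of k 0] show ?thesis by (simp add: bump_def[abs_def])
qed

lemma bump_nonneg: "0 \<le> bump s z x" and bump_le_1: "bump s z x \<le> 1"
  by (simp_all add: bump_def flat_0_le_1)

lemma bump_pos_iff: "s > 0 \<Longrightarrow> bump s z x > 0 \<longleftrightarrow> x \<in> ball z s"
proof -
  assume "s > 0"
  then have "norm (x - z) < s \<longleftrightarrow> (norm (x - z))\<^sup>2 < s\<^sup>2"
    using power_mono_iff[of s "norm (x - z)" 2] by (simp add: not_le[symmetric])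
  then show ?thesis by (auto simp: bump_def flat_def dist_norm norm_minus_commute)
qed

lemma test_functions_bump:
  assumes "s > 0" "cball z s \<subseteq> U"
  shows "bump s z \<in> test_functions U"
proof -
  have "{x. bump s z x \<noteq> 0} = ball z s"
    using bump_pos_iff[OF assms(1), of z] bump_nonneg[of s z] by (auto simp: less_le)
  then have "closure {x. bump s z x \<noteq> 0} = cball z s"
    using assms(1) by simp
  then show ?thesis
    using assms(2) by (simp only: test_functions_def mem_Collect_eq) (simp add: Ck_bump)
qed

subsection \<open>Test functions and integration by parts\<close>

lemma test_functions_mono: "U \<subseteq> V \<Longrightarrow> test_functions U \<subseteq> test_functions V"
  unfolding test_functions_def by blast

lemma partial_deriv_eq_0_outside:
  assumes "x \<notin> closure {x. \<phi> x \<noteq> 0}"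
  shows "partial_deriv i \<phi> x = 0"
proof -
  have "((\<lambda>x. 0) has_derivative (\<lambda>v. 0)) (at x)" by simp
  then have "(\<phi> has_derivative (\<lambda>v. 0)) (at x)"
    by (rule has_derivative_transform_within_open[where s = "- closure {x. \<phi> x \<noteq> 0}"])
      (use assms closure_subset[of "{x. \<phi> x \<noteq> 0}"] in auto)
  from partial_deriv_eq[OF this] show ?thesis by simp
qed

lemma test_functions_partial_deriv:
  assumes "\<phi> \<in> test_functions U"
  shows "partial_deriv i \<phi> \<in> test_functions U"
proof -
  have *: "compact (closure {x. \<phi> x \<noteq> 0})" "closure {x. \<phi> x \<noteq> 0} \<subseteq> U" "\<And>k. Ck (Suc k) \<phi>"
    using assms unfolding test_functions_def by blast+
  have "{x. partial_deriv i \<phi> x \<noteq> 0} \<subseteq> closure {x. \<phi> x \<noteq> 0}"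
    using partial_deriv_eq_0_outside by blast
  then have sub: "closure {x. partial_deriv i \<phi> x \<noteq> 0} \<subseteq> closure {x. \<phi> x \<noteq> 0}"
    by (simp add: closure_minimal)
  then have "compact (closure {x. partial_deriv i \<phi> x \<noteq> 0})"
    using *(1) by (meson bounded_subset closed_closure compact_eq_bounded_closed)
  with * sub show ?thesis unfolding test_functions_def by auto
qed

lemma assumes "\<phi> \<in> test_functions U"
  shows test_functions_continuous: "continuous_on UNIV \<phi>"
    and test_functions_differentiable: "\<phi> differentiable_on UNIV"
proof -
  from assms have *: "Ck k \<phi>" for k unfolding test_functions_def by blast
  show "continuous_on UNIV \<phi>" "\<phi> differentiable_on UNIV"
    using *[of 0] *[of "Suc 0"] by simp_all
qed

lemma test_functions_borel: "\<phi> \<in> test_functions U \<Longrightarrow> \<phi> \<in> borel_measurable borel"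
  by (intro borel_measurable_continuous_onI test_functions_continuous)

lemma test_functions_eq_0: "\<phi> \<in> test_functions U \<Longrightarrow> x \<notin> U \<Longrightarrow> \<phi> x = 0"
  unfolding test_functions_def mem_Collect_eq using closure_subset[of "{x. \<phi> x \<noteq> 0}"] by blast

lemma test_functions_bounded:
  assumes "\<phi> \<in> test_functions U"
  obtains B where "B \<ge> 0" "\<And>x. \<bar>\<phi> x\<bar> \<le> B"
proof -
  let ?S = "closure {x. \<phi> x \<noteq> 0}"
  have "compact ?S" using assms unfolding test_functions_def by blast
  then have "compact (\<phi> ` ?S)"
    using compact_continuous_image continuous_on_subset test_functions_continuous[OF assms] by blast
  then obtain B where B: "\<forall>y\<in>\<phi> ` ?S. norm y \<le> B"
    using compact_imp_bounded bounded_iff by metis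
  have "\<bar>\<phi> x\<bar> \<le> max 0 B" for x
  proof (cases "\<phi> x = 0")
    case False
    then have "x \<in> ?S" using closure_subset[of "{x. \<phi> x \<noteq> 0}"] by blast
    with B show ?thesis by fastforce
  qed simp
  then show ?thesis using that[of "max 0 B"] by simp
qed

lemma test_functions_integrable:
  fixes \<phi> :: "real ^ 'n::finite \<Rightarrow> real"
  assumes "\<phi> \<in> test_functions U"
  shows "integrable lborel \<phi>"
proof -
  let ?S = "closure {x. \<phi> x \<noteq> 0}"
  have S: "compact ?S" using assms unfolding test_functions_def by blast
  obtain B where B: "B \<ge> 0" "\<And>x. \<bar>\<phi> x\<bar> \<le> B" using test_functions_bounded[OF assms] by blast
  have "integrable lborel (\<lambda>x. indicator ?S x *\<^sub>R B)"
    using S emeasure_compact_finite[OF S] by (simp add: integrable_indicator_iff)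
  then show ?thesis
  proof (rule Bochner_Integration.integrable_bound)
    show "AE x in lborel. norm (\<phi> x) \<le> norm (indicator ?S x *\<^sub>R B)"
    proof (rule AE_I2)
      fix x
      show "norm (\<phi> x) \<le> norm (indicator ?S x *\<^sub>R B)"
        using B closure_subset[of "{x. \<phi> x \<noteq> 0}"]
        by (cases "\<phi> x = 0") (auto simp: indicator_def)
    qed
  qed (use test_functions_borel[OF assms] in simp)
qed

section \<open>Differentiation under the integral sign and integration by parts\<close>

lemma has_derivative_along_axis:
  fixes f :: "real ^ 'n::finite \<Rightarrow> real"
  assumes "f differentiable_on UNIV"
  shows "((\<lambda>t. f (x + t *\<^sub>R axis i 1)) has_real_derivative partial_deriv i f (x + t *\<^sub>R axis i 1)) (at t)"
proof -
  let ?y = "x + t *\<^sub>R axis i 1"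
  have f: "(f has_derivative frechet_derivative f (at ?y)) (at ?y)"
    using assms by (simp add: differentiable_on_def frechet_derivative_works[symmetric])
  then have lin: "linear (frechet_derivative f (at ?y))"
    using has_derivative_linear by blast
  have "((\<lambda>t. x + t *\<^sub>R axis i 1) has_derivative (\<lambda>h. h *\<^sub>R axis i 1)) (at t)"
    by (auto intro!: derivative_eq_intros)
  from has_derivative_compose[OF this f] have
    "((\<lambda>t. f (x + t *\<^sub>R axis i 1)) has_derivative (\<lambda>h. frechet_derivative f (at ?y) (h *\<^sub>R axis i 1))) (at t)" .
  then show ?thesis
    unfolding has_field_derivative_def partial_deriv_def
    by (simp add: linear_scale[OF lin] mult.commute[of _ "frechet_derivative f (at ?y) (axis i 1)"])
qed

text \<open>The shift acts on the test function, so \<open>g\<close> needs only to be integrable: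
  the mean value theorem bounds the difference quotients of \<open>\<phi>\<close> uniformly and
  dominated convergence applies. This serves both integration by parts and the derivatives of a
  mollification.\<close>

lemma has_derivative_integral_shift:
  fixes g \<phi> :: "real ^ 'n::finite \<Rightarrow> real"
  assumes g: "integrable lborel g" and \<phi>: "\<phi> \<in> test_functions U"
  shows "((\<lambda>t. \<integral>x. g x * \<phi> (x + t *\<^sub>R axis i 1) \<partial>lborel) has_real_derivative
    (\<integral>x. g x * partial_deriv i \<phi> (x + t *\<^sub>R axis i 1) \<partial>lborel)) (at t)"
proof -
  let ?e = "axis i 1 :: real ^ 'n" and ?D = "partial_deriv i \<phi>"
  have D: "?D \<in> test_functions U" using \<phi> by (rule test_functions_partial_deriv)
  note [measurable] = test_functions_borel[OF \<phi>] test_functions_borel[OF D] borel_measurable_integrable[OF g]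
  obtain B where B: "\<And>x. \<bar>\<phi> x\<bar> \<le> B" using test_functions_bounded[OF \<phi>] by blast
  obtain B' where B': "\<And>x. \<bar>?D x\<bar> \<le> B'" using test_functions_bounded[OF D] by blast
  have int: "integrable lborel (\<lambda>x. g x * \<phi> (x + s *\<^sub>R ?e))" for s
  proof (rule Bochner_Integration.integrable_bound)
    show "integrable lborel (\<lambda>x. g x * B)" using g by simp
    show "AE x in lborel. norm (g x * \<phi> (x + s *\<^sub>R ?e)) \<le> norm (g x * B)"
      using B by (auto simp: abs_mult intro!: mult_left_mono order_trans[OF B abs_ge_self])
  qed simp
  let ?F = "\<lambda>t. \<integral>x. g x * \<phi> (x + t *\<^sub>R ?e) \<partial>lborel"
  show ?thesis
    unfolding DERIV_def tendsto_at_iff_sequentially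
  proof (intro allI impI)
    fix X :: "nat \<Rightarrow> real"
    assume X0: "\<forall>k. X k \<in> UNIV - {0}" and X: "X \<longlonglongrightarrow> 0"
    have "(\<lambda>k. \<integral>x. g x * ((\<phi> (x + (t + X k) *\<^sub>R ?e) - \<phi> (x + t *\<^sub>R ?e)) / X k) \<partial>lborel)
        \<longlonglongrightarrow> (\<integral>x. g x * ?D (x + t *\<^sub>R ?e) \<partial>lborel)"
    proof (rule integral_dominated_convergence[where w = "\<lambda>x. norm (g x) * B'"])
      show "integrable lborel (\<lambda>x. norm (g x) * B')" using g by simp
      show "AE x in lborel. (\<lambda>k. g x * ((\<phi> (x + (t + X k) *\<^sub>R ?e) - \<phi> (x + t *\<^sub>R ?e)) / X k))
          \<longlonglongrightarrow> g x * ?D (x + t *\<^sub>R ?e)"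
      proof (intro AE_I2 tendsto_mult tendsto_const)
        fix x
        have "((\<lambda>h. (\<phi> (x + (t + h) *\<^sub>R ?e) - \<phi> (x + t *\<^sub>R ?e)) / h) \<longlongrightarrow> ?D (x + t *\<^sub>R ?e)) (at 0)"
          using has_derivative_along_axis[OF test_functions_differentiable[OF \<phi>], of x i t]
          by (simp only: DERIV_def)
        then show "(\<lambda>k. (\<phi> (x + (t + X k) *\<^sub>R ?e) - \<phi> (x + t *\<^sub>R ?e)) / X k) \<longlonglongrightarrow> ?D (x + t *\<^sub>R ?e)"
          using X0 X unfolding tendsto_at_iff_sequentially comp_def by blast
      qed
      fix k
      show "AE x in lborel. norm (g x * ((\<phi> (x + (t + X k) *\<^sub>R ?e) - \<phi> (x + t *\<^sub>R ?e)) / X k)) \<le> norm (g x) * B'"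
      proof (rule AE_I2)
        fix x
        have "norm (\<phi> (x + (t + X k) *\<^sub>R ?e) - \<phi> (x + t *\<^sub>R ?e)) \<le> B' * norm (t + X k - t)"
          by (rule field_differentiable_bound[of UNIV "\<lambda>t. \<phi> (x + t *\<^sub>R ?e)" "\<lambda>t. ?D (x + t *\<^sub>R ?e)"])
            (use B' has_derivative_along_axis[OF test_functions_differentiable[OF \<phi>]] in auto)
        then have "\<bar>\<phi> (x + (t + X k) *\<^sub>R ?e) - \<phi> (x + t *\<^sub>R ?e)\<bar> / \<bar>X k\<bar> \<le> B'"
          using X0 by (simp add: divide_le_eq)
        then show "norm (g x * ((\<phi> (x + (t + X k) *\<^sub>R ?e) - \<phi> (x + t *\<^sub>R ?e)) / X k)) \<le> norm (g x) * B'"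
          unfolding norm_mult by (intro mult_left_mono) auto
      qed
    qed measurable
    moreover have "(\<integral>x. g x * ((\<phi> (x + (t + h) *\<^sub>R ?e) - \<phi> (x + t *\<^sub>R ?e)) / h) \<partial>lborel) = (?F (t + h) - ?F t) / h" for h
    proof -
      have "?F (t + h) - ?F t = (\<integral>x. g x * (\<phi> (x + (t + h) *\<^sub>R ?e) - \<phi> (x + t *\<^sub>R ?e)) \<partial>lborel)"
        unfolding right_diff_distrib by (rule Bochner_Integration.integral_diff[OF int int, symmetric])
      then show ?thesis by simp
    qed
    ultimately show "((\<lambda>h. (?F (t + h) - ?F t) / h) \<circ> X) \<longlonglongrightarrow> (\<integral>x. g x * ?D (x + t *\<^sub>R ?e) \<partial>lborel)"
      by (simp only: comp_def)
  qed
qed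

lemma lborel_integral_translate:
  fixes f :: "'a::euclidean_space \<Rightarrow> real"
  assumes [measurable]: "f \<in> borel_measurable borel"
  shows "(\<integral>x. f (x + c) \<partial>lborel) = (\<integral>x. f x \<partial>lborel)"
proof -
  have "(\<integral>x. f x \<partial>lborel) = (\<integral>x. f x \<partial>distr lborel borel ((+) c))"
    by (simp only: lborel_distr_plus)
  also have "\<dots> = (\<integral>x. f (c + x) \<partial>lborel)"
    by (rule integral_distr) auto
  finally show ?thesis by (simp add: add.commute)
qed

lemma test_functions_Ck_mult:
  assumes h: "\<And>k. Ck k h" and \<phi>: "\<phi> \<in> test_functions U"
  shows "(\<lambda>x. h x * \<phi> x) \<in> test_functions U"
proof -
  have *: "\<And>k. Ck k \<phi>" "compact (closure {x. \<phi> x \<noteq> 0})" "closure {x. \<phi> x \<noteq> 0} \<subseteq> U"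
    using \<phi> unfolding test_functions_def by blast+
  have "closure {x. h x * \<phi> x \<noteq> 0} \<subseteq> closure {x. \<phi> x \<noteq> 0}"
    by (intro closure_mono) auto
  moreover from this have "compact (closure {x. h x * \<phi> x \<noteq> 0})"
    using *(2) bounded_subset by (auto simp: compact_eq_bounded_closed)
  moreover have "Ck k (\<lambda>x. h x * \<phi> x)" for k
    by (intro Ck_mult h *(1))
  ultimately show ?thesis
    unfolding test_functions_def using *(3) by blast
qed

text \<open>By translation invariance the integral of a shifted test function is constant in the
  shift, so its derivative vanishes.\<close>

lemma integral_partial_deriv_eq_0:
  fixes \<phi> :: "real ^ 'n::finite \<Rightarrow> real"
  assumes \<phi>: "\<phi> \<in> test_functions U"
  shows "(\<integral>x. partial_deriv i \<phi> x \<partial>lborel) = 0"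
proof -
  let ?e = "axis i 1 :: real ^ 'n"
  have "bounded {x. \<phi> x \<noteq> 0}"
    using \<phi> compact_imp_bounded bounded_subset closure_subset unfolding test_functions_def by blast
  then obtain R where R: "\<And>x. \<phi> x \<noteq> 0 \<Longrightarrow> norm x \<le> R"
    unfolding bounded_iff by blast
  \<comment> \<open>An integrable stand-in for the constant 1: the extra unit of radius contains the
    support of every shift with \<open>\<bar>t\<bar> < 1\<close>.\<close>
  let ?g = "indicator (cball 0 (R + 1)) :: real ^ 'n \<Rightarrow> real"
  have "integrable lborel ?g"
    using emeasure_compact_finite[OF compact_cball] by (simp add: integrable_indicator_iff)
  from has_derivative_integral_shift[OF this \<phi>, of i 0]
  have "((\<lambda>t. \<integral>x. ?g x * \<phi> (x + t *\<^sub>R ?e) \<partial>lborel) has_real_derivative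
      (\<integral>x. ?g x * partial_deriv i \<phi> x \<partial>lborel)) (at 0)" by simp
  moreover have "((\<lambda>t. \<integral>x. ?g x * \<phi> (x + t *\<^sub>R ?e) \<partial>lborel) has_real_derivative 0) (at 0)"
  proof (rule has_field_derivative_transform_within_open[where S = "{-1<..<1}" and f = "\<lambda>_. \<integral>x. \<phi> x \<partial>lborel"])
    fix t :: real assume t: "t \<in> {-1<..<1}"
    have "?g x * \<phi> (x + t *\<^sub>R ?e) = \<phi> (x + t *\<^sub>R ?e)" for x
    proof (cases "\<phi> (x + t *\<^sub>R ?e) = 0")
      case False
      have "norm x \<le> norm (x + t *\<^sub>R ?e) + norm (t *\<^sub>R ?e)"
        using norm_triangle_ineq4[of "x + t *\<^sub>R ?e" "t *\<^sub>R ?e"] by simp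
      also have "\<dots> \<le> R + 1" using R[OF False] t by (auto simp: norm_axis_1)
      finally show ?thesis by simp
    qed simp
    then show "(\<integral>x. \<phi> x \<partial>lborel) = (\<integral>x. ?g x * \<phi> (x + t *\<^sub>R ?e) \<partial>lborel)"
      by (simp only: lborel_integral_translate test_functions_borel[OF \<phi>])
  qed auto
  ultimately have "(\<integral>x. ?g x * partial_deriv i \<phi> x \<partial>lborel) = 0" by (rule DERIV_unique)
  moreover have "?g x * partial_deriv i \<phi> x = partial_deriv i \<phi> x" for x
  proof (cases "x \<in> closure {x. \<phi> x \<noteq> 0}")
    case True
    have "closure {x. \<phi> x \<noteq> 0} \<subseteq> cball 0 (R + 1)"
      by (rule closure_minimal) (use R in force)+
    with True show ?thesis by auto
  qed (simp add: partial_deriv_eq_0_outside)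
  ultimately show ?thesis by (simp only:)
qed

text \<open>The product \<open>h * \<phi>\<close> is again a test function, so its partial
  derivative integrates to 0; expand by the product rule.\<close>

lemma integral_by_parts_test_function:
  fixes h \<phi> :: "real ^ 'n::finite \<Rightarrow> real"
  assumes h: "\<And>k. Ck k h" and \<phi>: "\<phi> \<in> test_functions U"
  shows "(\<integral>x. h x * partial_deriv i \<phi> x \<partial>lborel) = - (\<integral>x. partial_deriv i h x * \<phi> x \<partial>lborel)"
proof -
  have dh: "Ck k (partial_deriv i h)" for k using h[of "Suc k"] by simp
  have "h differentiable_on UNIV" using h[of "Suc 0"] by simp
  from partial_deriv_combine(2)[OF this test_functions_differentiable[OF \<phi>], of i]
  have "0 = (\<integral>x. h x * partial_deriv i \<phi> x + partial_deriv i h x * \<phi> x \<partial>lborel)"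
    using integral_partial_deriv_eq_0[OF test_functions_Ck_mult[OF h \<phi>], of i] by simp
  also have "\<dots> = (\<integral>x. h x * partial_deriv i \<phi> x \<partial>lborel) + (\<integral>x. partial_deriv i h x * \<phi> x \<partial>lborel)"
    by (intro Bochner_Integration.integral_add test_functions_integrable[of _ U] test_functions_Ck_mult
        test_functions_partial_deriv h dh \<phi>)
  finally show ?thesis by simp
qed

subsection \<open>Uniqueness of weak gradients\<close>

lemma eucl_less_vec_iff: "eucl_less x y \<longleftrightarrow> (\<forall>i. x $ i < y $ i)" for x y :: "real ^ 'n::finite"
  by (auto simp: eucl_less_def Basis_vec_def inner_axis)

text \<open>Open orthants generate the Borel sets, so it is enough to approximate their indicator
  functions by test functions.\<close>

definition orthant_approx :: "real ^ 'n::finite \<Rightarrow> nat \<Rightarrow> real ^ 'n \<Rightarrow> real" where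
  "orthant_approx a k x =
     flat 0 (real k * (1 - 1 / (real k + 2) - (norm (x - 0))\<^sup>2)) * (\<Prod>i\<in>UNIV. flat 0 (real k * (a $ i - x $ i)))"

lemma orthant_approx_bounds: "0 \<le> orthant_approx a k x" "orthant_approx a k x \<le> 1"
proof -
  have "(\<Prod>i\<in>UNIV. flat 0 (real k * (a $ i - x $ i))) \<in> {0..1}"
    using flat_0_le_1 by (auto intro!: prod_nonneg prod_le_1)
  then show "0 \<le> orthant_approx a k x" "orthant_approx a k x \<le> 1"
    unfolding orthant_approx_def using flat_0_le_1 by (auto intro!: mult_nonneg_nonneg mult_le_one)
qed

lemma test_functions_orthant_approx: "orthant_approx a k \<in> test_functions (ball 0 1)"
proof -
  \<comment> \<open>Radii below 1 that increase to 1, so each support is a compact part of the open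
    ball; the 2 keeps the radius positive at \<open>k = 0\<close>.\<close>
  let ?r = "sqrt (1 - 1 / (real k + 2))"
  have "Ck l (\<lambda>x. real k * ((1 - 1 / (real k + 2)) + (-1) * (norm (x - 0))\<^sup>2))" for l
    by (intro Ck_add Ck_mult Ck_const Ck_dist_sq)
  from Ck_flat[OF this, of _ 0]
  have 1: "Ck l (\<lambda>x. flat 0 (real k * (1 - 1 / (real k + 2) - (norm (x - 0))\<^sup>2)))" for l by simp
  have "Ck l (\<lambda>x. real k * (a $ i + (-1) * x $ i))" for i l
    by (intro Ck_add Ck_mult Ck_const Ck_component)
  from Ck_flat[OF this, of _ 0]
  have 2: "Ck l (\<lambda>x. flat 0 (real k * (a $ i - x $ i)))" for i l by simp
  have Ck: "Ck l (orthant_approx a k)" for l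
    unfolding orthant_approx_def[abs_def] by (intro Ck_mult Ck_prod 1 2) simp
  have "{x. orthant_approx a k x \<noteq> 0} \<subseteq> cball 0 ?r"
  proof
    fix x assume "x \<in> {x. orthant_approx a k x \<noteq> 0}"
    then have "real k * (1 - 1 / (real k + 2) - (norm x)\<^sup>2) > 0"
      by (auto simp: orthant_approx_def flat_def split: if_splits)
    then have "(norm x)\<^sup>2 \<le> 1 - 1 / (real k + 2)"
      by (simp add: zero_less_mult_iff)
    then show "x \<in> cball 0 ?r" by (simp add: real_le_rsqrt)
  qed
  then have sub: "closure {x. orthant_approx a k x \<noteq> 0} \<subseteq> cball 0 ?r"
    by (simp add: closure_minimal)
  then have "compact (closure {x. orthant_approx a k x \<noteq> 0})"
    by (meson bounded_cball bounded_subset closed_closure compact_eq_bounded_closed)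
  moreover have "cball 0 ?r \<subseteq> (ball 0 1 :: (real ^ 'n) set)"
    by (auto simp: cball_subset_ball_iff)
  ultimately show ?thesis
    using Ck sub unfolding test_functions_def by blast
qed

text \<open>Inside, every cutoff is \<open>flat 0\<close> of an argument growing like
  \<open>k\<close>, hence tends to 1. Outside, some factor vanishes for every \<open>k\<close>, so
  the limit is the indicator everywhere, boundary included.\<close>

lemma orthant_approx_tendsto:
  "(\<lambda>k. orthant_approx a k x) \<longlonglongrightarrow> indicator (ball 0 1 \<inter> {x. eucl_less x a}) x"
proof (cases "x \<in> ball 0 1 \<inter> {x. eucl_less x a}")
  case True
  then have x: "norm x < 1" "\<And>i. x $ i < a $ i"
    by (auto simp: eucl_less_vec_iff)
  have "(norm x)\<^sup>2 < 1" using x(1) by (simp add: power_less_one_iff abs_square_less_1)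
  moreover have "(\<lambda>k. 1 / (real k + 2)) \<longlonglongrightarrow> 0"
    using LIMSEQ_ignore_initial_segment[OF lim_1_over_n[where 'a = real], of 2] by (simp add: add.commute)
  then have "(\<lambda>k. 1 - 1 / (real k + 2) - (norm (x - 0))\<^sup>2) \<longlonglongrightarrow> 1 - 0 - (norm (x - 0))\<^sup>2"
    by (intro tendsto_diff tendsto_const)
  ultimately have "filterlim (\<lambda>k. (1 - 1 / (real k + 2) - (norm (x - 0))\<^sup>2) * real k) at_top sequentially"
    by (intro filterlim_tendsto_pos_mult_at_top[OF _ _ filterlim_real_sequentially]) auto
  then have 1: "(\<lambda>k. flat 0 (real k * (1 - 1 / (real k + 2) - (norm (x - 0))\<^sup>2))) \<longlonglongrightarrow> 1"
    by (intro flat_0_scaled_tendsto) (simp add: mult.commute)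
  have "filterlim (\<lambda>k. (a $ i - x $ i) * real k) at_top sequentially" for i
    using x(2)[of i] by (intro filterlim_tendsto_pos_mult_at_top[OF tendsto_const _ filterlim_real_sequentially]) auto
  then have "(\<lambda>k. flat 0 (real k * (a $ i - x $ i))) \<longlonglongrightarrow> 1" for i
    by (intro flat_0_scaled_tendsto) (simp add: mult.commute)
  then have "(\<lambda>k. orthant_approx a k x) \<longlonglongrightarrow> 1 * (\<Prod>i\<in>(UNIV :: 'a set). 1)"
    unfolding orthant_approx_def by (intro tendsto_mult 1 tendsto_prod)
  then show ?thesis using True by simp
next
  case False
  have "orthant_approx a k x = 0" for k
  proof (cases "norm x < 1")
    case True
    then obtain i where "a $ i \<le> x $ i"
      using False by (auto simp: eucl_less_vec_iff not_less)
    then have "flat 0 (real k * (a $ i - x $ i)) = 0"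
      by (simp add: flat_def mult_nonneg_nonpos)
    then show ?thesis
      unfolding orthant_approx_def by (auto simp: prod_zero_iff)
  next
    case False
    then have "x \<notin> ball 0 1" by simp
    then show ?thesis
      using test_functions_eq_0 test_functions_orthant_approx by blast
  qed
  then show ?thesis using False by simp
qed

lemma lebesgue_on_integral_eq_lborel:
  fixes f :: "real ^ 'n::finite \<Rightarrow> real"
  assumes "U \<in> sets borel" "(\<lambda>x. indicator U x * f x) \<in> borel_measurable borel"
  shows "integral\<^sup>L (lebesgue_on U) f = (\<integral>x. indicator U x * f x \<partial>lborel)"
proof -
  have "integral\<^sup>L (lebesgue_on U) f = integral\<^sup>L lebesgue (\<lambda>x. indicator U x *\<^sub>R f x)"
    using assms(1) by (intro integral_restrict_space) simp
  also have "\<dots> = (\<integral>x. indicator U x * f x \<partial>lborel)"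
    using assms(2) by (simp add: integral_completion)
  finally show ?thesis .
qed

text \<open>The positive and negative parts of \<open>G\<close> are densities of two finite
  measures. They agree on open orthants, an intersection-stable generator, hence everywhere, and
  then the densities agree almost everywhere.\<close>

lemma fundamental_lemma_calculus_of_variations:
  fixes G :: "real ^ 'n::finite \<Rightarrow> real"
  assumes G: "integrable (lebesgue_on (ball 0 1)) G"
    and G0: "\<And>\<phi>. \<phi> \<in> test_functions (ball 0 1) \<Longrightarrow> integral\<^sup>L (lebesgue_on (ball 0 1)) (\<lambda>x. G x * \<phi> x) = 0"
  shows "AE x in lebesgue_on (ball 0 1). G x = 0"
proof -
  let ?B = "ball 0 1 :: (real ^ 'n) set"
  define H0 where "H0 x = indicator ?B x * G x" for x
  have H0: "integrable lebesgue H0"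
    using G by (simp add: integrable_restrict_space H0_def[abs_def])
  \<comment> \<open>The generator argument identifies measures on Borel sets, so the Lebesgue
    measurable zero extension is first replaced by a Borel representative.\<close>
  obtain H where H[measurable]: "H \<in> borel_measurable lborel" and HH: "AE x in lborel. H0 x = H x"
    using completion_ex_borel_measurable_real[OF borel_measurable_integrable[OF H0]] by blast
  have HH': "AE x in lebesgue. H0 x = H x" using HH by (rule AE_completion)
  have Hleb: "H \<in> borel_measurable lebesgue" using H by (rule measurable_completion)
  have "integrable lebesgue H"
    using integrable_cong_AE[OF borel_measurable_integrable[OF H0] Hleb HH'] H0 by blast
  then have Hi: "integrable lborel H" using integrable_completion[OF H] by blast
  have H\<phi>: "(\<integral>x. H x * \<phi> x \<partial>lborel) = 0" if "\<phi> \<in> test_functions ?B" for \<phi>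
  proof -
    have [measurable]: "\<phi> \<in> borel_measurable lborel" using test_functions_borel[OF that] by simp
    have \<phi>leb: "\<phi> \<in> borel_measurable lebesgue" by (rule measurable_completion) simp
    have "(\<integral>x. H x * \<phi> x \<partial>lborel) = integral\<^sup>L lebesgue (\<lambda>x. H x * \<phi> x)"
      by (rule integral_completion[symmetric]) measurable
    also have "\<dots> = integral\<^sup>L lebesgue (\<lambda>x. H0 x * \<phi> x)"
      using HH' Hleb \<phi>leb borel_measurable_integrable[OF H0]
      by (intro integral_cong_AE borel_measurable_times) auto
    also have "\<dots> = integral\<^sup>L (lebesgue_on ?B) (\<lambda>x. G x * \<phi> x)"
      by (simp add: integral_restrict_space H0_def mult.assoc)
    finally show ?thesis using G0[OF that] by simp
  qed
  have orth: "(\<integral>x. H x * indicator {x. eucl_less x a} x \<partial>lborel) = 0" for a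
  proof -
    have meas: "{x. eucl_less x a} \<in> sets borel" by (simp add: borel_eq_lessThan)
    have "(\<lambda>k. \<integral>x. H x * orthant_approx a k x \<partial>lborel) \<longlonglongrightarrow> (\<integral>x. H x * indicator (?B \<inter> {x. eucl_less x a}) x \<partial>lborel)"
    proof (rule integral_dominated_convergence[where w = "\<lambda>x. norm (H x)"])
      show "(\<lambda>x. H x * orthant_approx a k x) \<in> borel_measurable lborel" for k
        using test_functions_borel[OF test_functions_orthant_approx] by measurable
      show "AE x in lborel. norm (H x * orthant_approx a k x) \<le> norm (H x)" for k
        by (intro AE_I2) (simp add: abs_mult mult_left_le orthant_approx_bounds)
      show "(\<lambda>x. H x * indicator (?B \<inter> {x. eucl_less x a}) x) \<in> borel_measurable lborel"
        using H meas by (intro borel_measurable_times borel_measurable_indicator) auto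
    qed (use Hi in \<open>auto intro!: tendsto_mult orthant_approx_tendsto\<close>)
    then have "(\<integral>x. H x * indicator (?B \<inter> {x. eucl_less x a}) x \<partial>lborel) = 0"
      by (simp add: H\<phi>[OF test_functions_orthant_approx] LIMSEQ_const_iff)
    moreover have "(\<integral>x. H x * indicator (?B \<inter> {x. eucl_less x a}) x \<partial>lborel) = (\<integral>x. H x * indicator {x. eucl_less x a} x \<partial>lborel)"
    proof (rule integral_cong_AE)
      show "AE x in lborel. H x * indicator (?B \<inter> {x. eucl_less x a}) x = H x * indicator {x. eucl_less x a} x"
        using HH by eventually_elim (auto simp: H0_def indicator_def)
    qed (use H meas in \<open>auto intro!: borel_measurable_times borel_measurable_indicator\<close>)
    ultimately show ?thesis by simp
  qed
  let ?P = "density lborel (\<lambda>x. ennreal (H x))" and ?N = "density lborel (\<lambda>x. ennreal (- H x))"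
  have fin: "(\<integral>\<^sup>+x. ennreal (H x) \<partial>lborel) \<noteq> \<infinity>" "(\<integral>\<^sup>+x. ennreal (- H x) \<partial>lborel) \<noteq> \<infinity>"
    using Hi by (auto simp: real_integrable_def)
  have em: "emeasure ?P {x. eucl_less x a} = emeasure ?N {x. eucl_less x a}"
      "emeasure ?P {x. eucl_less x a} \<noteq> \<infinity>" for a
  proof -
    have S[measurable]: "{x. eucl_less x a} \<in> sets borel" by (simp add: borel_eq_lessThan)
    let ?g = "\<lambda>x. H x * indicator {x. eucl_less x a} x"
    have gi: "integrable lborel ?g"
      using integrable_mult_indicator[of "{x. eucl_less x a}" lborel H] Hi by (simp add: mult.commute)
    have P: "emeasure ?P {x. eucl_less x a} = (\<integral>\<^sup>+x. ennreal (?g x) \<partial>lborel)"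
      by (subst emeasure_density) (auto intro!: nn_integral_cong simp: indicator_def)
    have N: "emeasure ?N {x. eucl_less x a} = (\<integral>\<^sup>+x. ennreal (- ?g x) \<partial>lborel)"
      by (subst emeasure_density) (auto intro!: nn_integral_cong simp: indicator_def)
    have fin: "(\<integral>\<^sup>+x. ennreal (?g x) \<partial>lborel) \<noteq> \<infinity>" "(\<integral>\<^sup>+x. ennreal (- ?g x) \<partial>lborel) \<noteq> \<infinity>"
      using gi unfolding real_integrable_def by blast+
    have inj: "enn2real a = enn2real b \<Longrightarrow> a \<noteq> \<infinity> \<Longrightarrow> b \<noteq> \<infinity> \<Longrightarrow> a = b" for a b
      by (cases a; cases b) auto
    have "enn2real (\<integral>\<^sup>+x. ennreal (?g x) \<partial>lborel) = enn2real (\<integral>\<^sup>+x. ennreal (- ?g x) \<partial>lborel)"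
      using real_lebesgue_integral_def[OF gi] orth[of a] by simp
    then show "emeasure ?P {x. eucl_less x a} = emeasure ?N {x. eucl_less x a}" "emeasure ?P {x. eucl_less x a} \<noteq> \<infinity>"
      unfolding P N using inj[OF _ fin] fin by blast+
  qed
  have "?P = ?N"
  proof (rule measure_eqI_generator_eq[where \<Omega> = UNIV and E = "range (\<lambda>a. {x. eucl_less x a})"
        and A = "\<lambda>k. {x. eucl_less x (\<chi> i. real k)}"])
    show "Int_stable (range (\<lambda>a :: real ^ 'n. {x. eucl_less x a}))"
    proof (rule Int_stableI, clarify)
      fix a b :: "real ^ 'n"
      have "{x. eucl_less x a} \<inter> {x. eucl_less x b} = {x. eucl_less x (\<chi> i. min (a $ i) (b $ i))}"
        by (auto simp: eucl_less_vec_iff)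
      then show "{x. eucl_less x a} \<inter> {x. eucl_less x b} \<in> range (\<lambda>a. {x. eucl_less x a})" by blast
    qed
    show "(\<Union>k. {x. eucl_less x (\<chi> i. real k)}) = (UNIV :: (real ^ 'n) set)"
    proof (intro equalityI subset_UNIV subsetI)
      fix x :: "real ^ 'n"
      obtain k where "norm x < real k" using reals_Archimedean2 by blast
      then have "x $ i < real k" for i
        using component_le_norm_cart[of x i] by linarith
      then show "x \<in> (\<Union>k. {x. eucl_less x (\<chi> i. real k)})" by (auto simp: eucl_less_vec_iff)
    qed
  qed (use em in \<open>auto simp: borel_eq_lessThan\<close>)
  \<comment> \<open>Conversion to \<open>ennreal\<close> truncates negative values to 0, so one of
    the two sides is always 0 and equality forces \<open>H x = 0\<close>.\<close>
  then have "AE x in lborel. ennreal (H x) = ennreal (- H x)"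
    using fin by (subst (asm) finite_density_unique) auto
  then have "AE x in lborel. H x = 0"
    by eventually_elim (metis ennreal_eq_0_iff linorder_le_cases neg_0_le_iff_le neg_le_0_iff_le order_antisym)
  then have "AE x in lborel. H0 x = 0"
    using HH by eventually_elim simp
  then have "AE x in lebesgue. H0 x = 0" by (rule AE_completion)
  then show ?thesis
    by (subst AE_restrict_space_iff) (auto simp: H0_def elim!: eventually_mono)
qed

section \<open>Square-integrable functions and weak gradients on the unit ball\<close>

lemma finite_measure_unit_ball: "finite_measure (lebesgue_on (ball 0 1 :: (real ^ 'n::finite) set))"
  by (rule finite_measure_lebesgue_on) simp

lemma borel_measurable_lebesgue_onI:
  fixes f :: "real ^ 'n::finite \<Rightarrow> 'b::euclidean_space"
  assumes "f \<in> borel_measurable borel"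
  shows "f \<in> borel_measurable (lebesgue_on U)"
  using assms by (intro measurable_restrict_space1 measurable_completion) simp

lemma square_integrable_on_bounded:
  fixes f :: "real ^ 'n::finite \<Rightarrow> 'b::euclidean_space"
  assumes "f \<in> borel_measurable borel" "\<And>x. norm (f x) \<le> C"
  shows "square_integrable_on (ball 0 1) f"
proof -
  interpret finite_measure "lebesgue_on (ball 0 1 :: (real ^ 'n) set)" by (rule finite_measure_unit_ball)
  note [measurable] = borel_measurable_lebesgue_onI[OF assms(1)]
  have "(norm (f x))\<^sup>2 \<le> C\<^sup>2" for x
    using assms(2)[of x] by (intro power_mono) auto
  then show ?thesis
    unfolding square_integrable_on_def by (auto intro!: integrable_const_bound[where B = "C\<^sup>2"])
qed

lemma square_integrable_on_component:
  fixes G :: "real ^ 'n::finite \<Rightarrow> real ^ 'm::finite"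
  assumes "square_integrable_on U G"
  shows "square_integrable_on U (\<lambda>x. G x $ i)"
proof -
  have m: "G \<in> borel_measurable (lebesgue_on U)" and G: "integrable (lebesgue_on U) (\<lambda>x. (norm (G x))\<^sup>2)"
    using assms by (auto simp: square_integrable_on_def)
  have mi: "(\<lambda>x. G x $ i) \<in> borel_measurable (lebesgue_on U)"
    by (rule measurable_compose[OF m borel_measurable_continuous_onI]) (intro continuous_intros)
  have "integrable (lebesgue_on U) (\<lambda>x. (norm (G x $ i))\<^sup>2)"
  proof (rule Bochner_Integration.integrable_bound[OF G])
    show "AE x in lebesgue_on U. norm ((norm (G x $ i))\<^sup>2) \<le> norm ((norm (G x))\<^sup>2)"
      by (intro AE_I2) (simp add: abs_le_square_iff[symmetric] component_le_norm_cart)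
  qed (use mi in measurable)
  with mi show ?thesis unfolding square_integrable_on_def by simp
qed

lemma square_integrable_on_diff_scale:
  fixes f g :: "real ^ 'n::finite \<Rightarrow> 'b::euclidean_space"
  assumes "square_integrable_on U f" "square_integrable_on U g"
  shows "square_integrable_on U (\<lambda>x. f x - t *\<^sub>R g x)"
proof -
  have [measurable]: "f \<in> borel_measurable (lebesgue_on U)" "g \<in> borel_measurable (lebesgue_on U)"
    and i: "integrable (lebesgue_on U) (\<lambda>x. (norm (f x))\<^sup>2)" "integrable (lebesgue_on U) (\<lambda>x. (norm (g x))\<^sup>2)"
    using assms by (auto simp: square_integrable_on_def)
  have "(norm (f x - t *\<^sub>R g x))\<^sup>2 \<le> 2 * (norm (f x))\<^sup>2 + 2 * t\<^sup>2 * (norm (g x))\<^sup>2" for x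
  proof -
    have "norm (f x - t *\<^sub>R g x) \<le> norm (f x) + \<bar>t\<bar> * norm (g x)"
      using norm_triangle_ineq4[of "f x" "t *\<^sub>R g x"] by simp
    then have "(norm (f x - t *\<^sub>R g x))\<^sup>2 \<le> (norm (f x) + \<bar>t\<bar> * norm (g x))\<^sup>2"
      by (intro power_mono) auto
    also have "\<dots> \<le> 2 * (norm (f x))\<^sup>2 + 2 * t\<^sup>2 * (norm (g x))\<^sup>2"
      using zero_le_power2[of "norm (f x) - \<bar>t\<bar> * norm (g x)"]
      by (simp add: power2_sum power2_diff power_mult_distrib)
    finally show ?thesis .
  qed
  then have le: "norm ((norm (f x - t *\<^sub>R g x))\<^sup>2) \<le> norm (2 * (norm (f x))\<^sup>2 + 2 * t\<^sup>2 * (norm (g x))\<^sup>2)" for x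
    by (metis abs_ge_self abs_of_nonneg order_trans real_norm_def zero_le_power2)
  have "integrable (lebesgue_on U) (\<lambda>x. 2 * (norm (f x))\<^sup>2 + 2 * t\<^sup>2 * (norm (g x))\<^sup>2)"
    by (intro Bochner_Integration.integrable_add integrable_mult_right i)
  then have "integrable (lebesgue_on U) (\<lambda>x. (norm (f x - t *\<^sub>R g x))\<^sup>2)"
    by (rule Bochner_Integration.integrable_bound[OF _ _ AE_I2[OF le]]) measurable
  then show ?thesis unfolding square_integrable_on_def by simp
qed

lemma integrable_square_integrable_mult_test:
  fixes f :: "real ^ 'n::finite \<Rightarrow> real"
  assumes f: "square_integrable_on (ball 0 1) f" and \<phi>: "\<phi> \<in> test_functions U"
  shows "integrable (lebesgue_on (ball 0 1)) (\<lambda>x. f x * \<phi> x)"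
proof -
  interpret finite_measure "lebesgue_on (ball 0 1 :: (real ^ 'n) set)" by (rule finite_measure_unit_ball)
  obtain C where C: "C \<ge> 0" "\<And>x. \<bar>\<phi> x\<bar> \<le> C" using test_functions_bounded[OF \<phi>] by blast
  have [measurable]: "f \<in> borel_measurable (lebesgue_on (ball 0 1))"
    and i: "integrable (lebesgue_on (ball 0 1)) (\<lambda>x. (norm (f x))\<^sup>2)"
    using f by (auto simp: square_integrable_on_def)
  note [measurable] = borel_measurable_lebesgue_onI[OF test_functions_borel[OF \<phi>], of "ball 0 1"]
  have "norm (f x * \<phi> x) \<le> norm ((1 + (norm (f x))\<^sup>2) * C)" for x
  proof -
    have "2 * \<bar>f x\<bar> \<le> 1 + (f x)\<^sup>2"
      using zero_le_power2[of "\<bar>f x\<bar> - 1"] by (simp add: power2_diff)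
    then have "\<bar>f x\<bar> * \<bar>\<phi> x\<bar> \<le> (1 + (f x)\<^sup>2) * C"
      using C(2)[of x] by (intro mult_mono) auto
    then show ?thesis using C(1) by (simp add: abs_mult)
  qed
  moreover have "integrable (lebesgue_on (ball 0 1)) (\<lambda>x. (1 + (norm (f x))\<^sup>2) * C)"
    by (intro integrable_mult_left Bochner_Integration.integrable_add i) simp
  moreover have "(\<lambda>x. f x * \<phi> x) \<in> borel_measurable (lebesgue_on (ball 0 1))"
    by measurable
  ultimately show ?thesis
    by (rule_tac Bochner_Integration.integrable_bound[OF _ _ AE_I2])
qed

lemma has_weak_gradient_unique:
  fixes u :: "real ^ 'n::finite \<Rightarrow> real"
  assumes G: "has_weak_gradient (ball 0 1) u G" and H: "has_weak_gradient (ball 0 1) u H"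
  shows "AE x in lebesgue_on (ball 0 1). G x = H x"
proof -
  interpret finite_measure "lebesgue_on (ball 0 1 :: (real ^ 'n) set)" by (rule finite_measure_unit_ball)
  have sq: "square_integrable_on (ball 0 1) (\<lambda>x. G x $ i)" "square_integrable_on (ball 0 1) (\<lambda>x. H x $ i)" for i
    using G H unfolding has_weak_gradient_def by (blast intro: square_integrable_on_component)+
  have "AE x in lebesgue_on (ball 0 1). G x $ i - H x $ i = 0" for i
  proof (rule fundamental_lemma_calculus_of_variations)
    have "square_integrable_on (ball 0 1) (\<lambda>x. G x $ i - 1 *\<^sub>R (H x $ i))"
      by (intro square_integrable_on_diff_scale sq)
    then have "(\<lambda>x. G x $ i - H x $ i) \<in> borel_measurable (lebesgue_on (ball 0 1))"
      "integrable (lebesgue_on (ball 0 1)) (\<lambda>x. (G x $ i - H x $ i)\<^sup>2)"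
      unfolding square_integrable_on_def real_norm_def power2_abs by simp_all
    then show "integrable (lebesgue_on (ball 0 1)) (\<lambda>x. G x $ i - H x $ i)"
      by (rule square_integrable_imp_integrable)
    fix \<phi> assume \<phi>: "\<phi> \<in> test_functions (ball 0 1 :: (real ^ 'n) set)"
    have "integral\<^sup>L (lebesgue_on (ball 0 1)) (\<lambda>x. (G x $ i - H x $ i) * \<phi> x) =
        integral\<^sup>L (lebesgue_on (ball 0 1)) (\<lambda>x. G x $ i * \<phi> x) - integral\<^sup>L (lebesgue_on (ball 0 1)) (\<lambda>x. H x $ i * \<phi> x)"
      unfolding left_diff_distrib
      by (intro Bochner_Integration.integral_diff integrable_square_integrable_mult_test[OF sq(1) \<phi>]
          integrable_square_integrable_mult_test[OF sq(2) \<phi>])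
    also have "\<dots> = 0"
      using G H \<phi> unfolding has_weak_gradient_def by (metis (no_types, lifting) diff_self neg_equal_iff_equal)
    finally show "integral\<^sup>L (lebesgue_on (ball 0 1)) (\<lambda>x. (G x $ i - H x $ i) * \<phi> x) = 0" .
  qed
  then have "AE x in lebesgue_on (ball 0 1). \<forall>i. G x $ i - H x $ i = 0"
    by (simp add: AE_all_countable)
  then show ?thesis by eventually_elim (simp add: vec_eq_iff)
qed

text \<open>Frees the energy from the arbitrary choice in \<open>weak_gradient\<close>: any
  explicitly computed weak gradient may take its place under the integral.\<close>

lemma weak_gradient_AE_eq:
  assumes "has_weak_gradient (ball 0 1) u G"
  shows "AE x in lebesgue_on (ball 0 1). weak_gradient (ball 0 1) u x = G x"
  using has_weak_gradient_unique[OF _ assms] someI[of "has_weak_gradient (ball 0 1) u", OF assms]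
  unfolding weak_gradient_def by blast

lemma has_weak_gradient_weak_gradient:
  "u \<in> H1 U \<Longrightarrow> has_weak_gradient U u (weak_gradient U u)"
  unfolding H1_def weak_gradient_def using someI_ex[of "has_weak_gradient U u"] by blast

definition grad :: "(real ^ 'n::finite \<Rightarrow> real) \<Rightarrow> real ^ 'n \<Rightarrow> real ^ 'n" where
  "grad \<phi> x = (\<chi> i. partial_deriv i \<phi> x)"

lemma test_functions_integral_lebesgue_on:
  fixes \<phi> :: "real ^ 'n::finite \<Rightarrow> real"
  assumes \<phi>: "\<phi> \<in> test_functions (ball 0 1)" and f: "f \<in> borel_measurable borel"
  shows "integral\<^sup>L (lebesgue_on (ball 0 1)) (\<lambda>x. f x * \<phi> x) = (\<integral>x. f x * \<phi> x \<partial>lborel)"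
proof -
  have eq: "(\<lambda>x. indicator (ball 0 1) x * (f x * \<phi> x)) = (\<lambda>x. f x * \<phi> x)"
    by (rule ext) (use test_functions_eq_0[OF \<phi>] in \<open>auto simp: indicator_def\<close>)
  have "(\<lambda>x. f x * \<phi> x) \<in> borel_measurable borel"
    using f test_functions_borel[OF \<phi>] by measurable
  then show ?thesis
    using lebesgue_on_integral_eq_lborel[of "ball 0 1" "\<lambda>x. f x * \<phi> x"] unfolding eq by simp
qed

lemma has_weak_gradient_test_function:
  fixes \<phi> :: "real ^ 'n::finite \<Rightarrow> real"
  assumes \<phi>: "\<phi> \<in> test_functions (ball 0 1)"
  shows "has_weak_gradient (ball 0 1) \<phi> (grad \<phi>)"
  unfolding has_weak_gradient_def
proof (intro conjI ballI allI)
  show "square_integrable_on (ball 0 1) \<phi>"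
    using test_functions_bounded[OF \<phi>] by (metis square_integrable_on_bounded test_functions_borel[OF \<phi>] real_norm_def)
  have D: "partial_deriv i \<phi> \<in> test_functions (ball 0 1)" for i
    using \<phi> by (rule test_functions_partial_deriv)
  have "\<exists>C. \<forall>x. \<bar>partial_deriv i \<phi> x\<bar> \<le> C" for i
    using test_functions_bounded[OF D] by metis
  then obtain C where C: "\<And>i x. \<bar>partial_deriv i \<phi> x\<bar> \<le> C i" by metis
  show "square_integrable_on (ball 0 1) (grad \<phi>)"
  proof (rule square_integrable_on_bounded)
    show "grad \<phi> \<in> borel_measurable borel"
      unfolding grad_def[abs_def]
      by (intro borel_measurable_continuous_onI continuous_on_vec_lambda test_functions_continuous[OF D])
    show "norm (grad \<phi> x) \<le> (\<Sum>i\<in>UNIV. C i)" for x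
      by (rule order_trans[OF norm_le_l1_cart sum_mono]) (simp add: grad_def C)
  qed
  fix \<psi> i assume \<psi>: "\<psi> \<in> test_functions (ball 0 1 :: (real ^ 'n) set)"
  have "\<And>k. Ck k \<phi>" using \<phi> unfolding test_functions_def by blast
  from integral_by_parts_test_function[OF this \<psi>, of i]
  show "integral\<^sup>L (lebesgue_on (ball 0 1)) (\<lambda>x. \<phi> x * partial_deriv i \<psi> x) =
      - integral\<^sup>L (lebesgue_on (ball 0 1)) (\<lambda>x. grad \<phi> x $ i * \<psi> x)"
    by (simp add: grad_def test_functions_integral_lebesgue_on \<psi> test_functions_partial_deriv
        test_functions_borel[OF \<phi>] test_functions_borel[OF D])
qed

lemma has_weak_gradient_diff_scale:
  fixes u v :: "real ^ 'n::finite \<Rightarrow> real"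
  assumes u: "has_weak_gradient (ball 0 1) u G" and v: "has_weak_gradient (ball 0 1) v H"
  shows "has_weak_gradient (ball 0 1) (\<lambda>x. u x - t * v x) (\<lambda>x. G x - t *\<^sub>R H x)"
  unfolding has_weak_gradient_def
proof (intro conjI ballI allI)
  have sq: "square_integrable_on (ball 0 1) u" "square_integrable_on (ball 0 1) v"
      "square_integrable_on (ball 0 1) G" "square_integrable_on (ball 0 1) H"
    using u v unfolding has_weak_gradient_def by blast+
  show "square_integrable_on (ball 0 1) (\<lambda>x. u x - t * v x)"
    using square_integrable_on_diff_scale[OF sq(1,2), of t] by simp
  show "square_integrable_on (ball 0 1) (\<lambda>x. G x - t *\<^sub>R H x)"
    by (rule square_integrable_on_diff_scale[OF sq(3,4)])
  fix \<psi> i assume \<psi>: "\<psi> \<in> test_functions (ball 0 1 :: (real ^ 'n) set)"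
  then have D: "partial_deriv i \<psi> \<in> test_functions (ball 0 1)" by (rule test_functions_partial_deriv)
  let ?I = "integral\<^sup>L (lebesgue_on (ball 0 1 :: (real ^ 'n) set))"
  have "?I (\<lambda>x. (u x - t * v x) * partial_deriv i \<psi> x) = ?I (\<lambda>x. u x * partial_deriv i \<psi> x - t * (v x * partial_deriv i \<psi> x))"
    by (simp add: algebra_simps)
  also have "\<dots> = ?I (\<lambda>x. u x * partial_deriv i \<psi> x) - t * ?I (\<lambda>x. v x * partial_deriv i \<psi> x)"
    by (subst Bochner_Integration.integral_diff)
      (auto intro!: integrable_square_integrable_mult_test[OF sq(1) D] integrable_square_integrable_mult_test[OF sq(2) D])
  also have "\<dots> = - (?I (\<lambda>x. G x $ i * \<psi> x) - t * ?I (\<lambda>x. H x $ i * \<psi> x))"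
    using u v \<psi> unfolding has_weak_gradient_def by simp
  also have "\<dots> = - ?I (\<lambda>x. G x $ i * \<psi> x - t * (H x $ i * \<psi> x))"
    by (subst Bochner_Integration.integral_diff)
      (auto intro!: integrable_square_integrable_mult_test[OF square_integrable_on_component[OF sq(3)] \<psi>]
        integrable_square_integrable_mult_test[OF square_integrable_on_component[OF sq(4)] \<psi>])
  also have "\<dots> = - ?I (\<lambda>x. (G x - t *\<^sub>R H x) $ i * \<psi> x)"
    by (simp add: algebra_simps)
  finally show "?I (\<lambda>x. (u x - t * v x) * partial_deriv i \<psi> x) = - ?I (\<lambda>x. (G x - t *\<^sub>R H x) $ i * \<psi> x)" .
qed

lemma test_function_in_H10:
  fixes \<phi> :: "real ^ 'n::finite \<Rightarrow> real"
  assumes \<phi>: "\<phi> \<in> test_functions (ball 0 1)"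
  shows "\<phi> \<in> H10 (ball 0 1)"
proof -
  \<comment> \<open>The approximating sequence will be constantly \<open>\<phi>\<close>. What
    remains is that the chosen weak gradient of the zero function vanishes almost everywhere, which
    follows by viewing zero as a test function.\<close>
  have "(\<lambda>x :: real ^ 'n. 0 * \<phi> x) \<in> test_functions (ball 0 1)"
    by (rule test_functions_Ck_mult[OF Ck_const \<phi>])
  from weak_gradient_AE_eq[OF has_weak_gradient_test_function[OF this]]
  have "AE x in lebesgue_on (ball 0 1). weak_gradient (ball 0 1) (\<lambda>x :: real ^ 'n. 0) x = 0"
    by (simp add: grad_def[abs_def] partial_deriv_def zero_vec_def)
  then have "AE x in lebesgue_on (ball 0 1). 0\<^sup>2 + (norm (weak_gradient (ball 0 1) (\<lambda>x :: real ^ 'n. 0) x))\<^sup>2 = 0"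
    by eventually_elim simp
  then have "H1_norm (ball 0 1) (\<lambda>x. \<phi> x - \<phi> x) = 0"
    unfolding H1_norm_def by (simp add: integral_eq_zero_AE)
  moreover have "\<phi> \<in> H1 (ball 0 1)"
    unfolding H1_def using has_weak_gradient_test_function[OF \<phi>] by blast
  ultimately show ?thesis
    unfolding H10_def using \<phi> by (auto intro!: exI[of _ "\<lambda>_. \<phi>"])
qed

subsection \<open>The differential inequality for minimizers\<close>

text \<open>Weighted arithmetic-geometric mean inequality for \<open>b / a\<close> and 1, multiplied
  by \<open>a powr g\<close>. The tangent is taken at the larger point, later \<open>u x\<close>, so
  its slope does not depend on the competitor.\<close>

lemma powr_concave_tangent:
  fixes a b g :: real
  assumes "0 < b" "b \<le> a" "0 < g" "g \<le> 1"
  shows "b powr g \<le> a powr g - g * a powr (g - 1) * (a - b)"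
proof -
  have "(b / a) powr g * 1 powr (1 - g) \<le> g * (b / a) + (1 - g) * 1"
    using assms by (intro Youngs_inequality_0) auto
  then have "(b / a) powr g * a powr g \<le> (g * (b / a) + (1 - g)) * a powr g"
    by (simp add: mult_right_mono)
  moreover have "(b / a) powr g * a powr g = b powr g"
    using assms by (simp add: powr_divide)
  moreover have "a powr g = a powr (g - 1) * a"
    using assms by (simp add: powr_diff)
  ultimately have "b powr g \<le> (g * (b / a) + (1 - g)) * (a powr (g - 1) * a)" by simp
  also have "\<dots> = a powr (g - 1) * a - g * a powr (g - 1) * (a - b)"
    using assms by (simp add: field_simps)
  also have "a powr (g - 1) * a = a powr g"
    using assms by (simp add: powr_diff)
  finally show ?thesis .
qed

lemma linear_le_quadratic_imp_nonpos:
  fixes P Q \<epsilon> :: real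
  assumes "\<epsilon> > 0" and "\<And>t. 0 < t \<Longrightarrow> t < \<epsilon> \<Longrightarrow> t * P \<le> t\<^sup>2 * Q"
  shows "P \<le> 0"
proof -
  have lim: "((\<lambda>t. t * Q) \<longlongrightarrow> 0 * Q) (at_right 0)"
    by (intro tendsto_intros)
  have "\<forall>\<^sub>F t in at_right 0. P \<le> t * Q"
    unfolding eventually_at_right_field
  proof (intro exI[of _ \<epsilon>] conjI allI impI)
    fix t assume "0 < t" "t < \<epsilon>"
    with assms(2)[of t] show "P \<le> t * Q" by (simp add: power2_eq_square)
  qed (fact assms(1))
  then have "P \<le> 0 * Q"
    by (rule tendsto_lowerbound[OF lim]) simp
  then show ?thesis by simp
qed

text \<open>Comparing \<open>u\<close> with \<open>u - t \<phi>\<close>, which lies below it, concavity of the nonlinearity makes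
  the reaction term contribute with the favourable sign, so that only the limit \<open>t \<rightarrow> 0\<close> of a
  quadratic polynomial has to be taken.\<close>

lemma minimizer_differential_inequality:
  fixes u \<phi> \<delta> \<gamma> :: "real ^ 'n::finite \<Rightarrow> real" and \<kappa> :: real
  assumes min: "normalized_minimizer \<delta> \<gamma> u"
    and \<delta>: "bounded_measurable_nonneg \<delta>" and \<gamma>: "bounded_measurable_nonneg \<gamma>"
    and \<gamma>01: "AE x in lebesgue_on (ball 0 1). 0 < \<gamma> x \<and> \<gamma> x \<le> 1"
    and \<phi>: "\<phi> \<in> test_functions (ball 0 1)" and \<phi>0: "\<And>x. 0 \<le> \<phi> x"
    and pos: "\<And>x. x \<in> closure {x. \<phi> x \<noteq> 0} \<Longrightarrow> 0 < u x"
    and \<kappa>: "AE x in lebesgue_on (ball 0 1). \<phi> x \<noteq> 0 \<longrightarrow> \<kappa> \<le> \<delta> x * \<gamma> x * u x powr (\<gamma> x - 1)"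
  shows "\<kappa> * integral\<^sup>L (lebesgue_on (ball 0 1)) \<phi>
    \<le> (\<Sum>i\<in>UNIV. integral\<^sup>L (lebesgue_on (ball 0 1)) (\<lambda>x. u x * partial_deriv i (partial_deriv i \<phi>) x))"
proof -
  let ?B = "ball 0 1 :: (real ^ 'n) set"
  let ?I = "integral\<^sup>L (lebesgue_on ?B)"
  let ?int = "integrable (lebesgue_on ?B)"
  interpret finite_measure "lebesgue_on ?B" by (rule finite_measure_unit_ball)
  have cu: "continuous_on ?B u" and u01: "\<And>x. x \<in> ?B \<Longrightarrow> 0 \<le> u x \<and> u x \<le> 1"
    and uH1: "u \<in> H1 ?B"
    and J: "\<And>v. v \<in> H1 ?B \<Longrightarrow> (\<lambda>x. v x - u x) \<in> H10 ?B \<Longrightarrow> J_functional \<delta> \<gamma> u ?B \<le> J_functional \<delta> \<gamma> v ?B"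
    using min by (auto simp: normalized_minimizer_def local_minimizer_def)
  define G where "G = weak_gradient ?B u"
  have G: "has_weak_gradient ?B u G"
    unfolding G_def using uH1 by (rule has_weak_gradient_weak_gradient)
  note g\<phi> = has_weak_gradient_test_function[OF \<phi>]
  have sqG: "square_integrable_on ?B G" and "square_integrable_on ?B u"
    and sq\<phi>: "square_integrable_on ?B (grad \<phi>)" "square_integrable_on ?B \<phi>"
    using G g\<phi> by (auto simp: has_weak_gradient_def)
  then have [measurable]: "G \<in> borel_measurable (lebesgue_on ?B)" "u \<in> borel_measurable (lebesgue_on ?B)"
      "grad \<phi> \<in> borel_measurable (lebesgue_on ?B)" "\<phi> \<in> borel_measurable (lebesgue_on ?B)"
    and iG: "?int (\<lambda>x. (norm (G x))\<^sup>2)" and i\<phi>: "?int (\<lambda>x. (norm (grad \<phi> x))\<^sup>2)"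
    by (auto simp: square_integrable_on_def)
  have [measurable]: "\<delta> \<in> borel_measurable (lebesgue_on ?B)" "\<gamma> \<in> borel_measurable (lebesgue_on ?B)"
    using \<delta> \<gamma> by (auto simp: bounded_measurable_nonneg_def)
  obtain D where D: "\<And>x. x \<in> ?B \<Longrightarrow> \<delta> x \<le> D" "\<And>x. x \<in> ?B \<Longrightarrow> 0 \<le> \<delta> x" "\<And>x. x \<in> ?B \<Longrightarrow> 0 \<le> \<gamma> x"
    using \<delta> \<gamma> unfolding bounded_measurable_nonneg_def bounded_iff by (force simp: abs_le_iff)
  have iint: "?int (\<lambda>x. G x $ i * partial_deriv i \<phi> x)" for i
    by (rule integrable_square_integrable_mult_test[OF square_integrable_on_component[OF sqG]
        test_functions_partial_deriv[OF \<phi>]])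
  have inner_eq: "G x \<bullet> grad \<phi> x = (\<Sum>i\<in>UNIV. G x $ i * partial_deriv i \<phi> x)" for x
    by (simp add: inner_vec_def grad_def)
  have iin: "?int (\<lambda>x. G x \<bullet> grad \<phi> x)"
    unfolding inner_eq by (intro Bochner_Integration.integrable_sum iint)
  have i1: "?int \<phi>"
    using integrable_square_integrable_mult_test[OF square_integrable_on_bounded[of "\<lambda>_. 1" 1] \<phi>] by simp
  have ireact: "?int (\<lambda>x. \<delta> x * (max (v x) 0) powr \<gamma> x)"
    if [measurable]: "v \<in> borel_measurable (lebesgue_on ?B)" and v1: "\<And>x. x \<in> ?B \<Longrightarrow> v x \<le> 1" for v
  proof (rule integrable_const_bound[where B = D])
    show "AE x in lebesgue_on ?B. norm (\<delta> x * (max (v x) 0) powr \<gamma> x) \<le> D"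
    proof (rule AE_I2)
      fix x assume "x \<in> space (lebesgue_on ?B)"
      then have x: "x \<in> ?B" by simp
      have "(max (v x) 0) powr \<gamma> x \<le> 1"
        using v1[OF x] D(3)[OF x] by (intro powr_le1) auto
      then have "\<delta> x * (max (v x) 0) powr \<gamma> x \<le> D * 1"
        using D[OF x] by (intro mult_mono) auto
      then show "norm (\<delta> x * (max (v x) 0) powr \<gamma> x) \<le> D" using D(2)[OF x] by simp
    qed
  qed measurable
  let ?S = "closure {x. \<phi> x \<noteq> 0}"
  have S: "compact ?S" "?S \<subseteq> ?B" using \<phi> unfolding test_functions_def by blast+
  have sub: "\<phi> x \<noteq> 0 \<Longrightarrow> x \<in> ?S" for x using closure_subset[of "{x. \<phi> x \<noteq> 0}"] by blast
  \<comment> \<open>A positive lower bound for \<open>u\<close> on the compact support keeps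
    \<open>u - t * \<phi>\<close> positive there for small \<open>t\<close>, where the power is
    concave and differentiable.\<close>
  obtain c where c: "c > 0" "\<And>x. x \<in> ?S \<Longrightarrow> c \<le> u x"
  proof (cases "?S = {}")
    case True
    then show ?thesis using that[of 1] by auto
  next
    case False
    then obtain y where "y \<in> ?S" "\<And>x. x \<in> ?S \<Longrightarrow> u y \<le> u x"
      using continuous_attains_inf[OF S(1) False continuous_on_subset[OF cu S(2)]] by blast
    then show ?thesis using that[of "u y"] pos by blast
  qed
  obtain C where C: "C \<ge> 0" "\<And>x. \<bar>\<phi> x\<bar> \<le> C" using test_functions_bounded[OF \<phi>] by blast
  let ?P = "?I (\<lambda>x. G x \<bullet> grad \<phi> x)" and ?Q = "?I (\<lambda>x. (norm (grad \<phi> x))\<^sup>2)"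
  \<comment> \<open>Adding 1 to the bound \<open>C\<close> of \<open>\<phi>\<close> avoids dividing
    by zero when \<open>\<phi>\<close> vanishes identically.\<close>
  have step: "t * (?P + \<kappa> * ?I \<phi>) \<le> t\<^sup>2 * (?Q / 2)" if t: "0 < t" "t < c / (C + 1)" for t
  proof -
    define v where "v x = u x - t * \<phi> x" for x
    have upos: "t * \<phi> x < u x" if "\<phi> x \<noteq> 0" for x
    proof -
      have "t * \<phi> x \<le> t * C" using C(2)[of x] t by (intro mult_left_mono) auto
      also have "\<dots> \<le> t * (C + 1)" using t by simp
      also have "\<dots> < c" using t C(1) by (simp add: pos_less_divide_eq)
      finally show ?thesis using c(2)[OF sub[OF that]] by linarith
    qed
    have gv: "has_weak_gradient ?B v (\<lambda>x. G x - t *\<^sub>R grad \<phi> x)"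
      unfolding v_def[abs_def] by (rule has_weak_gradient_diff_scale[OF G g\<phi>])
    have v1: "v x \<le> 1" if "x \<in> ?B" for x
    proof -
      have "0 \<le> t * \<phi> x" using \<phi>0[of x] t(1) by simp
      with u01[OF that] show ?thesis by (simp add: v_def)
    qed
    have [measurable]: "v \<in> borel_measurable (lebesgue_on ?B)"
      unfolding v_def[abs_def] by measurable
    have "(\<lambda>x. v x - u x) = (\<lambda>x. (- t) * \<phi> x)" by (simp add: v_def fun_eq_iff)
    then have "(\<lambda>x. v x - u x) \<in> H10 ?B"
      using test_function_in_H10[OF test_functions_Ck_mult[OF Ck_const \<phi>, of "- t"]] by simp
    moreover have "v \<in> H1 ?B" using gv unfolding H1_def by blast
    ultimately have "J_functional \<delta> \<gamma> u ?B \<le> J_functional \<delta> \<gamma> v ?B" by (intro J)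
    let ?u = "\<lambda>x. 1 / 2 * (norm (G x))\<^sup>2 + \<delta> x * (max (u x) 0) powr \<gamma> x"
    let ?v = "\<lambda>x. 1 / 2 * (norm (G x - t *\<^sub>R grad \<phi> x))\<^sup>2 + \<delta> x * (max (v x) 0) powr \<gamma> x"
    \<comment> \<open>Pointwise majorant of the competitor's energy density: the gradient square is
      expanded exactly and the reaction term is bounded by its tangent, so the integral is a
      quadratic polynomial in \<open>t\<close>.\<close>
    let ?w = "\<lambda>x. ?u x - t * (G x \<bullet> grad \<phi> x) + t\<^sup>2 / 2 * (norm (grad \<phi> x))\<^sup>2 - t * \<kappa> * \<phi> x"
    have iu: "?int ?u"
      using u01 by (intro Bochner_Integration.integrable_add integrable_mult_right iG ireact) auto
    have iv: "?int ?v"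
    proof (intro Bochner_Integration.integrable_add integrable_mult_right ireact v1)
      show "?int (\<lambda>x. (norm (G x - t *\<^sub>R grad \<phi> x))\<^sup>2)"
        using square_integrable_on_diff_scale[OF sqG sq\<phi>(1)] by (simp add: square_integrable_on_def)
    qed measurable
    have iw: "?int ?w"
      by (intro Bochner_Integration.integrable_add Bochner_Integration.integrable_diff integrable_mult_right iu iin i\<phi> i1)
    have "J_functional \<delta> \<gamma> v ?B = ?I ?v"
      unfolding J_functional_def
    proof (rule integral_cong_AE)
      have "AE x in lebesgue_on ?B. weak_gradient ?B v x = G x - t *\<^sub>R grad \<phi> x"
        using gv by (rule weak_gradient_AE_eq)
      then show "AE x in lebesgue_on ?B. 1 / 2 * (norm (weak_gradient ?B v x))\<^sup>2 + \<delta> x * (max (v x) 0) powr \<gamma> x = ?v x"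
        by eventually_elim simp
      have [measurable]: "weak_gradient ?B v \<in> borel_measurable (lebesgue_on ?B)"
        using has_weak_gradient_weak_gradient[OF \<open>v \<in> H1 ?B\<close>]
        by (simp add: has_weak_gradient_def square_integrable_on_def)
      show "(\<lambda>x. 1 / 2 * (norm (weak_gradient ?B v x))\<^sup>2 + \<delta> x * (max (v x) 0) powr \<gamma> x) \<in> borel_measurable (lebesgue_on ?B)"
        by measurable
    qed (use iv in auto)
    moreover have "?I ?v \<le> ?I ?w"
    proof (rule integral_mono_AE[OF iv iw])
      show "AE x in lebesgue_on ?B. ?v x \<le> ?w x"
        using \<gamma>01 \<kappa> AE_space
      proof eventually_elim
        fix x
        assume g: "0 < \<gamma> x \<and> \<gamma> x \<le> 1" and k: "\<phi> x \<noteq> 0 \<longrightarrow> \<kappa> \<le> \<delta> x * \<gamma> x * u x powr (\<gamma> x - 1)"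
          and "x \<in> space (lebesgue_on ?B)"
        then have x: "x \<in> ?B" by simp
        have "\<delta> x * (max (v x) 0) powr \<gamma> x \<le> \<delta> x * (max (u x) 0) powr \<gamma> x - t * \<kappa> * \<phi> x"
        proof (cases "\<phi> x = 0")
          case False
          then have vp: "0 < v x" "v x \<le> u x" using upos \<phi>0[of x] t by (auto simp: v_def)
          have "v x powr \<gamma> x \<le> u x powr \<gamma> x - \<gamma> x * u x powr (\<gamma> x - 1) * (t * \<phi> x)"
            using powr_concave_tangent[OF vp, of "\<gamma> x"] g by (simp add: v_def)
          then have "\<delta> x * v x powr \<gamma> x \<le> \<delta> x * (u x powr \<gamma> x - \<gamma> x * u x powr (\<gamma> x - 1) * (t * \<phi> x))"
            using D(2)[OF x] by (intro mult_left_mono)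
          moreover have "\<kappa> * (t * \<phi> x) \<le> \<delta> x * \<gamma> x * u x powr (\<gamma> x - 1) * (t * \<phi> x)"
            using k False t \<phi>0[of x] by (intro mult_right_mono) auto
          ultimately show ?thesis using vp by (simp add: algebra_simps)
        qed (simp add: v_def)
        moreover have "(norm (G x - t *\<^sub>R grad \<phi> x))\<^sup>2 = (norm (G x))\<^sup>2 - 2 * t * (G x \<bullet> grad \<phi> x) + t\<^sup>2 * (norm (grad \<phi> x))\<^sup>2"
          unfolding power2_norm_eq_inner by (simp add: inner_diff_left inner_diff_right inner_commute algebra_simps power2_eq_square)
        ultimately show "?v x \<le> ?w x" by (simp add: algebra_simps)
      qed
    qed
    moreover have "?I ?w = ?I ?u - t * ?P + t\<^sup>2 / 2 * ?Q - t * \<kappa> * ?I \<phi>"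
      by (intro has_bochner_integral_integral_eq has_bochner_integral_add has_bochner_integral_diff
          has_bochner_integral_mult_right has_bochner_integral_integrable iu iin i\<phi> i1)
    moreover have "J_functional \<delta> \<gamma> u ?B = ?I ?u" by (simp add: J_functional_def G_def)
    ultimately show ?thesis using \<open>J_functional \<delta> \<gamma> u ?B \<le> J_functional \<delta> \<gamma> v ?B\<close>
      by (simp add: algebra_simps)
  qed
  have "?P + \<kappa> * ?I \<phi> \<le> 0"
    by (rule linear_le_quadratic_imp_nonpos[OF _ step]) (use c(1) C(1) in auto)
  \<comment> \<open>The definition of the weak gradient is tested with the partial derivatives of
    \<open>\<phi>\<close>, which moves both derivatives onto \<open>\<phi>\<close>.\<close>
  moreover have "?P = - (\<Sum>i\<in>UNIV. ?I (\<lambda>x. u x * partial_deriv i (partial_deriv i \<phi>) x))"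
    unfolding inner_eq using G test_functions_partial_deriv[OF \<phi>]
    by (subst Bochner_Integration.integral_sum[OF iint]) (simp add: has_weak_gradient_def sum_negf[symmetric])
  ultimately show ?thesis by linarith
qed

subsection \<open>Comparison with quadratic barriers\<close>

text \<open>If \<open>L\<close> were positive, \<open>f'\<close> would be positive just to the right
  of its zero at the origin and \<open>f\<close> would increase there. Only differentiability of
  \<open>f'\<close> at that single point enters.\<close>

lemma second_derivative_nonpos_at_max:
  fixes f f' :: "real \<Rightarrow> real"
  assumes s: "s > 0" and max: "\<And>t. \<bar>t\<bar> < s \<Longrightarrow> f t \<le> f 0"
    and f: "\<And>t. (f has_real_derivative f' t) (at t)" and f': "(f' has_real_derivative L) (at 0)"
  shows "L \<le> 0"
proof (rule ccontr)
  assume "\<not> L \<le> 0"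
  have "f' 0 = 0"
    by (rule DERIV_local_max[OF f s]) (use max in \<open>auto simp: dist_real_def\<close>)
  then obtain d where d: "d > 0" "\<And>h. 0 < h \<Longrightarrow> h < d \<Longrightarrow> 0 < f' h"
    using DERIV_pos_inc_right[OF f'] \<open>\<not> L \<le> 0\<close> by auto
  define b where "b = min d s / 2"
  have b: "0 < b" "b < d" "b < s" using d(1) s by (auto simp: b_def)
  have "f 0 < f b"
  proof (rule DERIV_pos_imp_increasing_open[OF b(1)])
    show "\<exists>y. (f has_real_derivative y) (at t) \<and> 0 < y" if "0 < t" "t < b" for t
      using f d(2)[of t] that b by (intro exI[of _ "f' t"]) auto
    show "continuous_on {0..b} f"
      using f by (intro continuous_at_imp_continuous_on) (blast intro: DERIV_isCont)
  qed
  then show False using max[of b] b by simp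
qed

section \<open>Mollification with bump kernels\<close>

lemma bump_commute: "bump s z x = bump s x z"
  by (simp add: bump_def norm_minus_commute)

lemma continuous_on_integral_bump:
  fixes g :: "real ^ 'n::finite \<Rightarrow> real"
  assumes g: "integrable lborel g" and s: "s > 0"
  shows "continuous_on A (\<lambda>z. \<integral>x. g x * bump s z x \<partial>lborel)"
proof (rule continuous_on_sequentiallyI)
  fix X :: "nat \<Rightarrow> real ^ 'n" and z assume X: "X \<longlonglongrightarrow> z"
  have tf: "bump s y \<in> test_functions UNIV" for y :: "real ^ 'n" using s by (rule test_functions_bump) simp
  note [measurable] = borel_measurable_integrable[OF g] test_functions_borel[OF tf]
  show "(\<lambda>k. \<integral>x. g x * bump s (X k) x \<partial>lborel) \<longlonglongrightarrow> (\<integral>x. g x * bump s z x \<partial>lborel)"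
  proof (rule integral_dominated_convergence[where w = "\<lambda>x. norm (g x)"])
    show "AE x in lborel. (\<lambda>k. g x * bump s (X k) x) \<longlonglongrightarrow> g x * bump s z x"
    proof (intro AE_I2 tendsto_mult tendsto_const)
      fix x
      have "isCont (bump s x) z"
        using test_functions_continuous[OF tf, of x] by (simp add: continuous_on_eq_continuous_at)
      from isCont_tendsto_compose[OF this X] show "(\<lambda>k. bump s (X k) x) \<longlonglongrightarrow> bump s z x"
        by (simp add: bump_commute[of s _ x])
    qed
    show "AE x in lborel. norm (g x * bump s (X k) x) \<le> norm (g x)" for k
      by (intro AE_I2) (simp add: abs_mult mult_left_le bump_nonneg bump_le_1)
  qed (use g in auto)
qed

lemma integral_bump:
  fixes z :: "real ^ 'n::finite"
  assumes s: "s > 0"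
  shows "(\<integral>x. bump s z x \<partial>lborel) = (\<integral>x. bump s (0 :: real ^ 'n) x \<partial>lborel)" "0 < (\<integral>x. bump s (0 :: real ^ 'n) x \<partial>lborel)"
proof -
  have tf: "bump s y \<in> test_functions UNIV" for y :: "real ^ 'n" using s by (rule test_functions_bump) simp
  note [measurable] = test_functions_borel[OF tf]
  show "(\<integral>x. bump s z x \<partial>lborel) = (\<integral>x. bump s (0 :: real ^ 'n) x \<partial>lborel)"
    using lborel_integral_translate[OF test_functions_borel[OF tf], of 0 "- z"]
    by (simp add: bump_def)
  have "(\<integral>x. bump s (0 :: real ^ 'n) x \<partial>lborel) \<noteq> 0"
  proof
    assume "(\<integral>x. bump s (0 :: real ^ 'n) x \<partial>lborel) = 0"
    then have "AE x in lborel. bump s (0 :: real ^ 'n) x = 0"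
      using integral_nonneg_eq_0_iff_AE[OF test_functions_integrable[OF tf]] bump_nonneg by blast
    then have "AE x in lborel. x \<notin> ball (0 :: real ^ 'n) s"
      by eventually_elim (metis bump_pos_iff[OF s] less_irrefl)
    then have "emeasure lborel (ball (0 :: real ^ 'n) s) = 0"
      by (subst (asm) AE_iff_measurable[of "ball 0 s"]) auto
    then show False
      using content_ball_pos[OF s, of "0 :: real ^ 'n"] by (simp add: measure_def)
  qed
  moreover have "0 \<le> (\<integral>x. bump s (0 :: real ^ 'n) x \<partial>lborel)"
    by (simp add: bump_nonneg)
  ultimately show "0 < (\<integral>x. bump s (0 :: real ^ 'n) x \<partial>lborel)" by simp
qed

lemma partial_deriv_quadratic:
  fixes y :: "real ^ 'n::finite"
  shows "Ck k (\<lambda>x. m + K * (norm (x - y))\<^sup>2)"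
    and "partial_deriv i (partial_deriv i (\<lambda>x. m + K * (norm (x - y))\<^sup>2)) x = 2 * K"
proof -
  show "Ck k (\<lambda>x. m + K * (norm (x - y))\<^sup>2)"
    by (intro Ck_add Ck_mult Ck_const Ck_dist_sq)
  have "((\<lambda>x. m + K * ((x - y) \<bullet> (x - y))) has_derivative (\<lambda>v. K * (2 * ((x - y) \<bullet> v)))) (at x)" for x
    by (auto intro!: derivative_eq_intros simp: inner_commute algebra_simps)
  from partial_deriv_eq[OF this]
  have 1: "partial_deriv i (\<lambda>x. m + K * (norm (x - y))\<^sup>2) = (\<lambda>x. 2 * K * (x $ i - y $ i))"
    by (simp add: fun_eq_iff power2_norm_eq_inner inner_axis)
  have "((\<lambda>x. 2 * K * (x $ i - y $ i)) has_derivative (\<lambda>v. 2 * K * v $ i)) (at x)"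
    by (auto intro!: derivative_eq_intros bounded_linear_imp_has_derivative bounded_linear_vec_nth)
  from partial_deriv_eq[OF this]
  show "partial_deriv i (partial_deriv i (\<lambda>x. m + K * (norm (x - y))\<^sup>2)) x = 2 * K"
    unfolding 1 by (simp add: axis_def)
qed

text \<open>A positive maximum of \<open>u - h\<close> survives mollification. At a maximum point of the mollified
  difference all pure second derivatives are nonpositive, which contradicts the differential
  inequality tested with the mollifying kernel centred there.\<close>

lemma minimizer_le_quadratic_barrier:
  fixes u \<delta> \<gamma> :: "real ^ 'n::finite \<Rightarrow> real" and \<kappa> K m r :: real and y z\<^sub>0 :: "real ^ 'n"
  defines "h \<equiv> \<lambda>x. m + K * (norm (x - y))\<^sup>2"
  assumes min: "normalized_minimizer \<delta> \<gamma> u"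
    and \<delta>: "bounded_measurable_nonneg \<delta>" and \<gamma>: "bounded_measurable_nonneg \<gamma>"
    and \<gamma>01: "AE x in lebesgue_on (ball 0 1). 0 < \<gamma> x \<and> \<gamma> x \<le> 1"
    and ball: "cball z\<^sub>0 r \<subseteq> ball 0 1" and Km: "0 \<le> K" "0 \<le> m"
    and bdry: "\<And>x. x \<in> sphere z\<^sub>0 r \<Longrightarrow> u x \<le> h x"
    and \<kappa>: "AE x in lebesgue_on (ball 0 1).
      x \<in> ball z\<^sub>0 r \<and> h x < u x \<longrightarrow> \<kappa> \<le> \<delta> x * \<gamma> x * u x powr (\<gamma> x - 1)"
    and lap: "2 * K * real CARD('n) < \<kappa>"
    and x: "x \<in> ball z\<^sub>0 r"
  shows "u x \<le> h x"
proof (rule ccontr)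
  assume neg: "\<not> u x \<le> h x"
  let ?B = "ball 0 1 :: (real ^ 'n) set" and ?C = "cball z\<^sub>0 r"
  define w where "w x = u x - h x" for x
  have h0: "0 \<le> h x" for x using Km by (simp add: h_def)
  have ch: "continuous_on S h" for S unfolding h_def by (intro continuous_intros)
  have cu: "continuous_on ?B u" using min by (simp add: normalized_minimizer_def)
  then have cuC: "continuous_on ?C u" using ball continuous_on_subset by blast
  have cw: "continuous_on ?C w" unfolding w_def[abs_def] by (intro continuous_on_diff cuC ch)
  have "?C \<noteq> {}" using subsetD[OF ball_subset_cball x] by blast
  then obtain xm where xm: "xm \<in> ?C" "\<And>x. x \<in> ?C \<Longrightarrow> w x \<le> w xm"
    using continuous_attains_sup[OF compact_cball _ cw] by blast
  define \<mu> where "\<mu> = w xm"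
  have "0 < w x" using neg by (simp add: w_def)
  then have \<mu>: "0 < \<mu>" using xm(2)[of x] x by (simp add: \<mu>_def)
  \<comment> \<open>On the sphere \<open>w \<le> 0\<close>, so this superlevel set is a compact
    subset of the open set where \<open>w\<close> is positive; the mollification is maximized over
    it.\<close>
  define A where "A = {x \<in> ?C. \<mu> / 2 \<le> w x}"
  have "A = ?C \<inter> w -` {\<mu> / 2..}" by (auto simp: A_def)
  then have "closed A"
    using continuous_closed_preimage[OF cw closed_cball closed_atLeast] by simp
  have "A \<subseteq> ?C" by (auto simp: A_def)
  with \<open>closed A\<close> have A: "compact A" "A \<subseteq> ?C"
    using bounded_subset[OF bounded_cball] by (auto simp: compact_eq_bounded_closed)
  define V where "V = {x \<in> ball z\<^sub>0 r. 0 < w x}"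
  have "V = ball z\<^sub>0 r \<inter> w -` {0<..}" by (auto simp: V_def)
  then have "open V"
    using continuous_open_preimage[OF continuous_on_subset[OF cw ball_subset_cball] open_ball open_greaterThan]
    by simp
  have "A \<subseteq> V"
  proof
    fix x assume xA: "x \<in> A"
    have "x \<notin> sphere z\<^sub>0 r"
      using bdry[of x] xA \<mu> by (auto simp: A_def w_def)
    then show "x \<in> V" using xA \<mu> by (auto simp: A_def V_def)
  qed
  obtain e where e: "e > 0" "(\<Union>x\<in>A. cball x e) \<subseteq> V"
    using compact_subset_open_imp_cball_epsilon_subset[OF A(1) \<open>open V\<close> \<open>A \<subseteq> V\<close>] by blast
  obtain d where d: "d > 0" "\<And>x x'. x \<in> ?C \<Longrightarrow> x' \<in> ?C \<Longrightarrow> dist x' x < d \<Longrightarrow> dist (w x') (w x) < \<mu> / 8"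
    using compact_uniformly_continuous[OF cw compact_cball, unfolded uniformly_continuous_on_def,
        THEN spec, of "\<mu> / 8"] \<mu> by auto
  \<comment> \<open>The kernel radius keeps supports centred in \<open>A\<close> inside
    \<open>V\<close>; halving \<open>d\<close> makes even the closed balls satisfy the strict
    continuity estimate.\<close>
  define s where "s = min e (d / 2)"
  have s: "s > 0" using e d by (simp add: s_def)
  have VC: "V \<subseteq> ?C" "V \<subseteq> ?B" using ball by (auto simp: V_def)
  have sV: "cball z s \<subseteq> V" if "z \<in> A" for z
  proof -
    have "cball z s \<subseteq> cball z e" by (rule subset_cball) (simp add: s_def)
    also have "\<dots> \<subseteq> V" using e(2) that by blast
    finally show ?thesis .
  qed
  have close: "\<bar>w x - w z\<bar> < \<mu> / 8" if "z \<in> A" "x \<in> cball z s" for x z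
  proof -
    have "s < d" using d(1) by (simp add: s_def min_def)
    then have "dist x z < d" using that(2) by (simp add: dist_commute)
    moreover have "z \<in> ?C" "x \<in> ?C" using that sV VC(1) A(2) by blast+
    ultimately show ?thesis using d(2)[of z x] by (simp add: dist_real_def)
  qed
  \<comment> \<open>The zero extension is integrable on the whole space and agrees with
    \<open>w\<close> on the support of every kernel centred in \<open>A\<close>.\<close>
  define g where "g x = indicator ?C x * w x" for x
  have g: "integrable lborel g"
    using borel_integrable_compact[OF compact_cball cw] by (simp add: g_def[abs_def])
  define W where "W z = (\<integral>x. g x * bump s z x \<partial>lborel)" for z
  define I where "I = (\<integral>x. bump s (0 :: real ^ 'n) x \<partial>lborel)"
  have I: "0 < I" unfolding I_def by (rule integral_bump(2)[OF s])
  have tf: "bump s z \<in> test_functions UNIV" for z :: "real ^ 'n" using s by (rule test_functions_bump) simp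
  note [measurable] = borel_measurable_integrable[OF g] test_functions_borel[OF tf]
  have gb: "integrable lborel (\<lambda>x. g x * bump s z x)" for z
    using g by (rule Bochner_Integration.integrable_bound)
      (auto simp: abs_mult mult_left_le bump_nonneg bump_le_1)
  have approx: "\<bar>W z - I * w z\<bar> \<le> I * (\<mu> / 8)" if z: "z \<in> A" for z
  proof -
    have bi: "integrable lborel (bump s z)" by (rule test_functions_integrable[OF tf])
    have "W z - I * w z = (\<integral>x. g x * bump s z x - w z * bump s z x \<partial>lborel)"
      unfolding W_def I_def integral_bump(1)[OF s, of z, symmetric]
      by (simp add: Bochner_Integration.integral_diff[OF gb integrable_mult_right[OF bi]])
    also have "\<bar>\<dots>\<bar> \<le> (\<integral>x. \<bar>g x * bump s z x - w z * bump s z x\<bar> \<partial>lborel)"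
      by (rule integral_abs_bound)
    also have "\<dots> \<le> (\<integral>x. \<mu> / 8 * bump s z x \<partial>lborel)"
    proof (rule integral_mono)
      fix x
      show "\<bar>g x * bump s z x - w z * bump s z x\<bar> \<le> \<mu> / 8 * bump s z x"
      proof (cases "x \<in> ball z s")
        case True
        then have xz: "x \<in> cball z s" by simp
        then have "x \<in> ?C" using sV[OF z] VC(1) by blast
        then have "g x = w x" "\<bar>w x - w z\<bar> < \<mu> / 8"
          using close[OF z xz] by (simp_all add: g_def)
        then have "\<bar>g x - w z\<bar> * bump s z x \<le> \<mu> / 8 * bump s z x"
          using bump_nonneg by (intro mult_right_mono) auto
        then show ?thesis
          by (simp add: left_diff_distrib[symmetric] abs_mult bump_nonneg)
      next
        case False
        then have "bump s z x = 0" using bump_pos_iff[OF s, of z x] bump_nonneg[of s z x] by simp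
        then show ?thesis by simp
      qed
    qed (use gb bi in auto)
    also have "\<dots> = I * (\<mu> / 8)"
      by (simp add: I_def integral_bump(1)[OF s, of z])
    finally show ?thesis .
  qed
  have xmA: "xm \<in> A" using xm(1) \<mu> by (simp add: A_def \<mu>_def)
  have "continuous_on A W"
    unfolding W_def[abs_def] by (rule continuous_on_integral_bump[OF g s])
  then obtain x0 where x0: "x0 \<in> A" "\<And>z. z \<in> A \<Longrightarrow> W z \<le> W x0"
    using continuous_attains_sup[OF A(1)] xmA by blast
  \<comment> \<open>\<open>W\<close> differs from \<open>I * w\<close> by at most
    \<open>I * \<mu> / 8\<close> on \<open>A\<close>. Maximality of \<open>W\<close> at
    \<open>x0\<close> thus gives \<open>w x0 \<ge> 3 / 4 * \<mu>\<close>, and one more variation of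
    \<open>\<mu> / 8\<close> still leaves \<open>w\<close> above \<open>\<mu> / 2\<close>: the
    \<open>s\<close>-ball about \<open>x0\<close> lies in \<open>A\<close>, so the maximum is
    interior.\<close>
  have "I * (\<mu> - \<mu> / 8) \<le> I * (w x0 + \<mu> / 8)"
    using x0(2)[OF xmA] approx[OF xmA] approx[OF x0(1)]
    unfolding \<mu>_def[symmetric] right_diff_distrib distrib_left by linarith
  then have wx0: "3 / 4 * \<mu> \<le> w x0" using I by (simp add: mult_le_cancel_left)
  have locmax: "W (x0 + t *\<^sub>R axis i 1) \<le> W x0" if t: "\<bar>t\<bar> < s" for i t
  proof (rule x0(2))
    let ?z = "x0 + t *\<^sub>R axis i 1"
    have "?z \<in> cball x0 s" using t by (simp add: dist_norm norm_axis_1)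
    then have "?z \<in> ?C" "\<bar>w ?z - w x0\<bar> < \<mu> / 8"
      using sV[OF x0(1)] VC(1) close[OF x0(1)] by blast+
    then show "?z \<in> A" unfolding A_def mem_Collect_eq using wx0 \<mu> by linarith
  qed
  let ?\<phi> = "bump s x0"
  have \<phi>: "?\<phi> \<in> test_functions V" using s sV[OF x0(1)] by (rule test_functions_bump)
  have \<phi>1: "partial_deriv i ?\<phi> \<in> test_functions V" for i by (rule test_functions_partial_deriv[OF \<phi>])
  have \<phi>2: "partial_deriv i (partial_deriv i ?\<phi>) \<in> test_functions V" for i by (rule test_functions_partial_deriv[OF \<phi>1])
  have second: "(\<integral>x. g x * partial_deriv i (partial_deriv i ?\<phi>) x \<partial>lborel) \<le> 0" for i
  proof -
    let ?e = "axis i 1 :: real ^ 'n"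
    \<comment> \<open>Moving the centre backwards is the same as shifting the argument of the kernel
      forwards, so derivatives of \<open>W\<close> fall on the kernel.\<close>
    have W': "W (x0 + (- t) *\<^sub>R ?e) = (\<integral>x. g x * ?\<phi> (x + t *\<^sub>R ?e) \<partial>lborel)" for t
      unfolding W_def by (simp add: bump_def algebra_simps)
    show ?thesis
    proof (rule second_derivative_nonpos_at_max[OF s])
      show "(\<integral>x. g x * ?\<phi> (x + t *\<^sub>R ?e) \<partial>lborel) \<le> (\<integral>x. g x * ?\<phi> (x + 0 *\<^sub>R ?e) \<partial>lborel)" if "\<bar>t\<bar> < s" for t
        using locmax[of "- t" i] W'[of t] W'[of 0] that by simp
      show "((\<lambda>t. \<integral>x. g x * ?\<phi> (x + t *\<^sub>R ?e) \<partial>lborel) has_real_derivative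
          (\<integral>x. g x * partial_deriv i ?\<phi> (x + t *\<^sub>R ?e) \<partial>lborel)) (at t)" for t
        by (rule has_derivative_integral_shift[OF g \<phi>])
      show "((\<lambda>t. \<integral>x. g x * partial_deriv i ?\<phi> (x + t *\<^sub>R ?e) \<partial>lborel) has_real_derivative
          (\<integral>x. g x * partial_deriv i (partial_deriv i ?\<phi>) x \<partial>lborel)) (at 0)"
        using has_derivative_integral_shift[OF g \<phi>1[of i], of i 0] by simp
    qed
  qed
  have Ckh: "Ck k h" for k unfolding h_def by (rule partial_deriv_quadratic(1))
  have Ckh1: "Ck k (partial_deriv i h)" for k i using Ckh[of "Suc k"] by simp
  have hpart: "(\<integral>x. h x * partial_deriv i (partial_deriv i ?\<phi>) x \<partial>lborel) = 2 * K * I" for i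
  proof -
    have "(\<integral>x. h x * partial_deriv i (partial_deriv i ?\<phi>) x \<partial>lborel)
        = (\<integral>x. partial_deriv i (partial_deriv i h) x * ?\<phi> x \<partial>lborel)"
      using integral_by_parts_test_function[OF Ckh \<phi>1[of i], of i] integral_by_parts_test_function[OF Ckh1[of _ i] \<phi>, of i]
      by simp
    also have "\<dots> = 2 * K * I"
      using integral_bump(1)[OF s, of x0] by (simp add: h_def partial_deriv_quadratic(2) I_def)
    finally show ?thesis .
  qed
  have ineq: "\<kappa> * integral\<^sup>L (lebesgue_on ?B) ?\<phi>
    \<le> (\<Sum>i\<in>UNIV. integral\<^sup>L (lebesgue_on ?B) (\<lambda>x. u x * partial_deriv i (partial_deriv i ?\<phi>) x))"
  proof (rule minimizer_differential_inequality[OF min \<delta> \<gamma> \<gamma>01 _ bump_nonneg])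
    show "?\<phi> \<in> test_functions ?B" using \<phi> test_functions_mono[OF VC(2)] by blast
    show "0 < u x" if "x \<in> closure {x. ?\<phi> x \<noteq> 0}" for x
    proof -
      have "x \<in> V" using that \<phi> unfolding test_functions_def by blast
      then show ?thesis using h0[of x] by (simp add: V_def w_def)
    qed
    show "AE x in lebesgue_on ?B. ?\<phi> x \<noteq> 0 \<longrightarrow> \<kappa> \<le> \<delta> x * \<gamma> x * u x powr (\<gamma> x - 1)"
      using \<kappa>
    proof eventually_elim
      case (elim x)
      have "x \<in> V" if "?\<phi> x \<noteq> 0" using test_functions_eq_0[OF \<phi>] that by blast
      with elim show ?case by (auto simp: V_def w_def)
    qed
  qed
  have "integral\<^sup>L (lebesgue_on ?B) (\<lambda>x. u x * partial_deriv i (partial_deriv i ?\<phi>) x) \<le> 2 * K * I" for i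
  proof -
    let ?D = "partial_deriv i (partial_deriv i ?\<phi>)"
    have eq: "indicator ?B x * (u x * ?D x) = g x * ?D x + h x * ?D x" for x
    proof (cases "x \<in> V")
      case True
      then have "x \<in> ?C" "x \<in> ?B" using VC by blast+
      then show ?thesis by (simp add: g_def w_def algebra_simps)
    qed (simp add: test_functions_eq_0[OF \<phi>2])
    have [measurable]: "?D \<in> borel_measurable borel" by (rule test_functions_borel[OF \<phi>2])
    have "h \<in> borel_measurable borel" using ch by (rule borel_measurable_continuous_onI)
    then have "integral\<^sup>L (lebesgue_on ?B) (\<lambda>x. u x * ?D x) = (\<integral>x. g x * ?D x + h x * ?D x \<partial>lborel)"
      by (subst lebesgue_on_integral_eq_lborel) (simp_all add: eq)
    also have "\<dots> = (\<integral>x. g x * ?D x \<partial>lborel) + (\<integral>x. h x * ?D x \<partial>lborel)"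
    proof (rule Bochner_Integration.integral_add)
      show "integrable lborel (\<lambda>x. h x * ?D x)"
        by (rule test_functions_integrable[OF test_functions_Ck_mult[OF Ckh \<phi>2]])
      obtain c where c: "\<And>x. \<bar>?D x\<bar> \<le> c" using test_functions_bounded[OF \<phi>2] by blast
      have "integrable lborel (\<lambda>x. c * g x)" using g by simp
      then show "integrable lborel (\<lambda>x. g x * ?D x)"
        by (rule Bochner_Integration.integrable_bound)
          (auto simp: abs_mult mult.commute[of _ "\<bar>g _\<bar>"] intro!: mult_left_mono order_trans[OF c abs_ge_self])
    qed
    finally show ?thesis using second[of i] hpart[of i] by simp
  qed
  then have "(\<Sum>i\<in>UNIV. integral\<^sup>L (lebesgue_on ?B) (\<lambda>x. u x * partial_deriv i (partial_deriv i ?\<phi>) x))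
      \<le> (\<Sum>i\<in>(UNIV :: 'n set). 2 * K * I)"
    by (intro sum_mono) blast
  moreover have "integral\<^sup>L (lebesgue_on ?B) ?\<phi> = I"
    using test_functions_integral_lebesgue_on[of ?\<phi> "\<lambda>_. 1"] \<phi> test_functions_mono[OF VC(2)]
      integral_bump(1)[OF s, of x0] by (auto simp: I_def)
  ultimately have "\<kappa> * I \<le> (2 * K * real CARD('n)) * I"
    using ineq by (simp add: mult_ac)
  then show False using lap I by simp
qed

subsection \<open>Nondegeneracy\<close>

lemma AE_unit_ball_imp_ex:
  fixes S :: "(real ^ 'n::finite) set"
  assumes AE: "AE x in lebesgue_on (ball 0 1). P x" and S: "open S" "S \<noteq> {}" "S \<subseteq> ball 0 1"
  shows "\<exists>x\<in>S. P x"
proof (rule ccontr)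
  assume neg: "\<not> (\<exists>x\<in>S. P x)"
  have "AE x in lebesgue. x \<in> ball 0 1 \<longrightarrow> P x"
    using AE by (subst (asm) AE_restrict_space_iff) auto
  then have "AE x in lebesgue. x \<notin> S"
    by eventually_elim (use neg S(3) in blast)
  then have "S \<in> null_sets lebesgue"
    using S(1) by (subst AE_iff_null_sets) auto
  then show False
    using open_not_negligible[OF S(1,2)] by (simp add: negligible_iff_null_sets)
qed

text \<open>The final exponent contains the point value of \<open>\<gamma>\<close> at the free
  boundary point, while \<open>\<gamma>\<close> is bounded by 1 only almost everywhere. A violation
  at a point of continuity would persist on an open set, which is not null.\<close>

lemma isCont_AE_le:
  fixes f :: "real ^ 'n::finite \<Rightarrow> real"
  assumes f: "isCont f z" and z: "z \<in> ball 0 1" and AE: "AE x in lebesgue_on (ball 0 1). f x \<le> b"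
  shows "f z \<le> b"
proof (rule ccontr)
  assume "\<not> f z \<le> b"
  then have "\<forall>\<^sub>F x in nhds z. b < f x"
    using order_tendstoD(1)[of f "f z" "nhds z" b] f by (simp add: isCont_def tendsto_at_iff_tendsto_nhds)
  then obtain S where S: "open S" "z \<in> S" "\<And>x. x \<in> S \<Longrightarrow> b < f x"
    unfolding eventually_nhds by blast
  have "\<exists>x\<in>S \<inter> ball 0 1. f x \<le> b"
    by (rule AE_unit_ball_imp_ex[OF AE]) (use S z in auto)
  then show False using S(3) by force
qed

lemma ess_lower_AE:
  "ess_lower f 0 1 = ereal b \<Longrightarrow> AE x in lebesgue_on (ball 0 1). b \<le> f x"
proof -
  assume "ess_lower f 0 1 = ereal b"
  then have "esssup (lebesgue_on (ball 0 1)) (\<lambda>x. - ereal (f x)) = ereal (- b)"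
    by (simp add: ess_lower_def essinf_def ereal_uminus_eq_reorder)
  moreover have "AE x in lebesgue_on (ball 0 1). - ereal (f x) \<le> esssup (lebesgue_on (ball 0 1)) (\<lambda>x. - ereal (f x))"
    by (rule esssup_AE)
  ultimately show ?thesis by simp
qed

lemma ess_upper_AE:
  "ess_upper f 0 1 \<le> ereal b \<Longrightarrow> AE x in lebesgue_on (ball 0 1). f x \<le> b"
proof -
  assume *: "ess_upper f 0 1 \<le> ereal b"
  have "AE x in lebesgue_on (ball 0 1). ereal (f x) \<le> ess_upper f 0 1"
    unfolding ess_upper_def by (rule esssup_AE)
  then show ?thesis
    by eventually_elim (use * order_trans in fastforce)
qed

text \<open>The exponent \<open>2 / (2 - g)\<close> is the one for which \<open>M / r\<^sup>2\<close> and \<open>M powr (g - 1)\<close> scale alike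
  when \<open>M\<close> is of order \<open>r powr (2 / (2 - g))\<close>; the modulus enters through the factor
  \<open>r powr w\<close>, which \<open>w * ln (1 / r) \<le> A\<close> bounds from below.\<close>

lemma barrier_slope_less:
  fixes M c r g w A a n :: real
  assumes M: "0 < M" "M < c * r powr (2 / (2 - g))" and c: "0 < c" "c \<le> 1" "sqrt c \<le> a * exp (- 2 * A) / (16 * n)"
    and r: "0 < r" "r < 1" and g: "0 \<le> g" "g \<le> 1" and w: "0 \<le> w" "w \<le> 1 / 2" "w * ln (1 / r) \<le> A"
    and a: "0 < a" and n: "0 < n"
  shows "2 * (4 * M / r\<^sup>2) * n < a * M powr (g - 1 + w)"
proof -
  define p where "p = 2 - g - w"
  define b where "b = 2 / (2 - g)"
  have p: "1 / 2 \<le> p" using g w by (simp add: p_def)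
  have "2 - g \<noteq> 0" using g by simp
  then have "b * (2 - g) = 2" unfolding b_def by (metis nonzero_eq_divide_eq)
  then have "b * p = 2 - b * w" by (simp add: p_def algebra_simps)
  moreover have "0 < b" "b \<le> 2" using g by (simp_all add: b_def divide_le_eq)
  ultimately have b: "0 < b" "b \<le> 2" "b * p = 2 - b * w" by blast+
  have L: "0 \<le> w * ln (1 / r)" using r w by simp
  \<comment> \<open>Only here does the logarithmic condition act: as \<open>b \<le> 2\<close>,
    replacing \<open>b * p\<close> by 2 in the exponent of \<open>r\<close> costs at most the factor
    \<open>exp (- 2 * A)\<close>.\<close>
  have "b * (w * ln (1 / r)) \<le> 2 * A"
    using mult_mono[OF b(2) w(3)] L by simp
  then have "exp (- 2 * A) \<le> r powr (b * w)"
    using r by (simp add: powr_def ln_div)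
  then have rp: "exp (- 2 * A) / r\<^sup>2 \<le> r powr (- (b * p))"
    using r b(3) by (simp add: powr_diff divide_right_mono)
  have "16 * n / (a * exp (- 2 * A)) \<le> 1 / sqrt c"
  proof -
    have "sqrt c * (16 * n) \<le> a * exp (- 2 * A)"
      using c(3) n by (simp add: pos_le_divide_eq)
    then have "16 * n \<le> a * exp (- 2 * A) / sqrt c"
      using c(1) by (simp add: pos_le_divide_eq mult.commute)
    then show ?thesis using a by (simp add: pos_divide_le_eq)
  qed
  also have "\<dots> = c powr (- (1 / 2))"
    by (simp only: powr_minus powr_half_sqrt[OF less_imp_le[OF c(1)]] inverse_eq_divide)
  \<comment> \<open>Since \<open>c \<le> 1\<close> and \<open>p \<ge> 1 / 2\<close>, the square root
    bounds the worst case over all admissible \<open>g\<close> and \<open>w\<close>.\<close>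
  also have "\<dots> \<le> c powr (- p)"
    using c p by (intro powr_mono') auto
  finally have cp: "16 * n / (a * exp (- 2 * A)) \<le> c powr (- p)" .
  \<comment> \<open>Doubling 8 to 16 is the slack that makes the final inequality strict.\<close>
  have "2 * 4 * n / r\<^sup>2 < 16 * n / r\<^sup>2"
    using n r by (simp add: divide_strict_right_mono)
  also have "\<dots> = a * (16 * n / (a * exp (- 2 * A)) * (exp (- 2 * A) / r\<^sup>2))"
    using a by simp
  also have "\<dots> \<le> a * (c powr (- p) * r powr (- (b * p)))"
    using cp rp a n by (intro mult_left_mono mult_mono) auto
  also have "c powr (- p) * r powr (- (b * p)) = (c * r powr b) powr (- p)"
    using c r by (simp add: powr_mult powr_powr)
  \<comment> \<open>The exponent is negative, so the upper bound on \<open>M\<close> suffices,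
    however small \<open>M\<close> may be.\<close>
  also have "\<dots> \<le> M powr (- p)"
    using M p unfolding b_def by (intro powr_mono2') auto
  finally have "2 * 4 * n / r\<^sup>2 < a * M powr (- p)"
    using a by simp
  then have "2 * 4 * n / r\<^sup>2 * M < a * M powr (- p) * M"
    using M by (intro mult_strict_right_mono)
  also have "a * M powr (- p) * M = a * M powr (g - 1 + w)"
  proof -
    have "g - 1 + w = - p + 1" by (simp add: p_def)
    then have "M powr (g - 1 + w) = M powr (- p) * M powr 1" by (simp only: powr_add)
    then show ?thesis using M(1) by simp
  qed
  finally show ?thesis by (simp add: mult_ac)
qed

text \<open>The limsup is below infinity, so any real number above it bounds the expression near 0.
  \<open>A\<close> is taken positive because it is later divided out.\<close>

lemma logarithmic_modulus_bound:
  fixes \<omega> :: "real \<Rightarrow> real" and C :: real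
  assumes "ereal (\<omega> 1) + Limsup (at_right 0) (\<lambda>t. ereal (\<omega> t * ln (1 / t))) \<le> ereal C"
  obtains A t\<^sub>0 where "A > 0" "t\<^sub>0 > 0" "\<And>t. 0 < t \<Longrightarrow> t < t\<^sub>0 \<Longrightarrow> \<omega> t * ln (1 / t) \<le> A"
proof -
  define L where "L = Limsup (at_right 0) (\<lambda>t. ereal (\<omega> t * ln (1 / t)))"
  have "L \<noteq> \<infinity>" using assms unfolding L_def[symmetric] by auto
  then obtain A where A: "A > 0" "L < ereal A"
  proof (cases L)
    case (real l)
    then show ?thesis using that[of "max 0 l + 1"] by simp
  qed (use that[of 1] in auto)
  have "\<forall>\<^sub>F t in at_right 0. ereal (\<omega> t * ln (1 / t)) < ereal A"
    using A(2) unfolding L_def by (rule Limsup_lessD)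
  then obtain t\<^sub>0 where "t\<^sub>0 > 0" "\<And>t. 0 < t \<Longrightarrow> t < t\<^sub>0 \<Longrightarrow> \<omega> t * ln (1 / t) < A"
    unfolding eventually_at_right_field by auto
  with A(1) show ?thesis using that[of A t\<^sub>0] by force
qed

text \<open>Universality is encoded by the order of quantifiers: the radius and the constant are
  fixed from the data before \<open>\<delta>\<close>, \<open>\<gamma>\<close>, \<open>u\<close> and
  \<open>z\<^sub>0\<close> are introduced.\<close>

theorem theorem4p2:
  fixes \<delta>\<^sub>0 \<delta>sup \<gamma>\<^sub>0 C :: real and \<omega> :: "real \<Rightarrow> real"
  assumes "\<delta>\<^sub>0 > 0" and "\<gamma>\<^sub>0 > 0" and "C > 0"
    and "ereal (\<omega> 1) + Limsup (at_right 0) (\<lambda>t. ereal (\<omega> t * ln (1 / t))) \<le> ereal C"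
  shows "\<exists>r\<^sub>0>0. \<exists>c>0.
    \<forall>(\<delta> :: real ^ 'n::finite \<Rightarrow> real) (\<gamma> :: real ^ 'n \<Rightarrow> real) (u :: real ^ 'n \<Rightarrow> real) (z\<^sub>0 :: real ^ 'n).
      bounded_measurable_nonneg \<delta> \<and> bounded_measurable_nonneg \<gamma> \<and>
      ess_lower \<delta> 0 1 = ereal \<delta>\<^sub>0 \<and>
      esssup (lebesgue_on (ball 0 1)) (\<lambda>x. ereal \<bar>\<delta> x\<bar>) = ereal \<delta>sup \<and>
      ess_lower \<gamma> 0 1 = ereal \<gamma>\<^sub>0 \<and> ess_upper \<gamma> 0 1 \<le> 1 \<and>
      normalized_minimizer \<delta> \<gamma> u \<and>
      z\<^sub>0 \<in> free_boundary u \<inter> ball 0 (1 / 2) \<and>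
      isCont \<gamma> z\<^sub>0 \<and> modulus_at \<omega> \<gamma> z\<^sub>0 \<longrightarrow>
      (\<forall>r. 0 < r \<and> r < r\<^sub>0 \<longrightarrow>
        Sup (u ` sphere z\<^sub>0 r) \<ge> c * r powr (2 / (2 - \<gamma> z\<^sub>0)))"
proof -
  obtain A t\<^sub>0 where A: "A > 0" and t\<^sub>0: "t\<^sub>0 > 0" "\<And>t. 0 < t \<Longrightarrow> t < t\<^sub>0 \<Longrightarrow> \<omega> t * ln (1 / t) \<le> A"
    using logarithmic_modulus_bound[OF assms(4)] by blast
  define n where "n = real CARD('n)"
  define a where "a = \<delta>\<^sub>0 * \<gamma>\<^sub>0"
  \<comment> \<open>\<open>t\<^sub>0\<close> activates the modulus bound, 1/2 keeps the balls inside
    the unit ball, and \<open>exp (- 2 * A)\<close> gives \<open>ln (1 / r) \<ge> 2 * A\<close>,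
    whence \<open>\<omega> r \<le> 1 / 2\<close>.\<close>
  define r\<^sub>0 where "r\<^sub>0 = min t\<^sub>0 (min (1 / 2) (exp (- 2 * A)))"
  define c where "c = min 1 ((a * exp (- 2 * A) / (16 * n))\<^sup>2)"
  have n: "n > 0" by (simp add: n_def)
  have a: "a > 0" using assms by (simp add: a_def)
  have r\<^sub>0: "r\<^sub>0 > 0" using t\<^sub>0(1) by (simp add: r\<^sub>0_def)
  have c: "0 < c" "c \<le> 1" using a n by (auto simp: c_def)
  have "sqrt c \<le> sqrt ((a * exp (- 2 * A) / (16 * n))\<^sup>2)"
    by (simp only: real_sqrt_le_iff) (simp add: c_def)
  then have sqc: "sqrt c \<le> a * exp (- 2 * A) / (16 * n)" using a n by simp
  show ?thesis
  proof (rule exI[of _ r\<^sub>0], rule conjI[OF r\<^sub>0], rule exI[of _ c], rule conjI[OF c(1)], intro allI impI)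
    fix \<delta> \<gamma> u :: "real ^ 'n \<Rightarrow> real" and z\<^sub>0 :: "real ^ 'n" and r :: real
    assume hyp: "bounded_measurable_nonneg \<delta> \<and> bounded_measurable_nonneg \<gamma> \<and>
      ess_lower \<delta> 0 1 = ereal \<delta>\<^sub>0 \<and>
      esssup (lebesgue_on (ball 0 1)) (\<lambda>x. ereal \<bar>\<delta> x\<bar>) = ereal \<delta>sup \<and>
      ess_lower \<gamma> 0 1 = ereal \<gamma>\<^sub>0 \<and> ess_upper \<gamma> 0 1 \<le> 1 \<and>
      normalized_minimizer \<delta> \<gamma> u \<and>
      z\<^sub>0 \<in> free_boundary u \<inter> ball 0 (1 / 2) \<and>
      isCont \<gamma> z\<^sub>0 \<and> modulus_at \<omega> \<gamma> z\<^sub>0" and r: "0 < r \<and> r < r\<^sub>0"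
    let ?B = "ball 0 1 :: (real ^ 'n) set"
    have \<delta>: "bounded_measurable_nonneg \<delta>" and \<gamma>: "bounded_measurable_nonneg \<gamma>"
      and min: "normalized_minimizer \<delta> \<gamma> u" and fb: "z\<^sub>0 \<in> free_boundary u"
      and z0: "z\<^sub>0 \<in> ball 0 (1 / 2)" and cont: "isCont \<gamma> z\<^sub>0"
      and mono: "mono_on {0..} \<omega>" and modulus: "\<And>x. x \<in> ?B \<Longrightarrow> \<bar>\<gamma> x - \<gamma> z\<^sub>0\<bar> \<le> \<omega> (norm (x - z\<^sub>0))"
      using hyp by (auto simp: modulus_at_def)
    have AE\<delta>: "AE x in lebesgue_on ?B. \<delta>\<^sub>0 \<le> \<delta> x" and AE\<gamma>: "AE x in lebesgue_on ?B. \<gamma>\<^sub>0 \<le> \<gamma> x"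
      and AE\<gamma>1: "AE x in lebesgue_on ?B. \<gamma> x \<le> 1"
      using hyp ess_lower_AE ess_upper_AE[of \<gamma> 1] unfolding one_ereal_def by blast+
    have AE01: "AE x in lebesgue_on ?B. 0 < \<gamma> x \<and> \<gamma> x \<le> 1"
      using AE\<gamma> AE\<gamma>1 by eventually_elim (use assms(2) in auto)
    have u01: "0 \<le> u x" "u x \<le> 1" if "x \<in> ?B" for x
      using min that by (auto simp: normalized_minimizer_def)
    have zB: "z\<^sub>0 \<in> ?B" using z0 by simp
    define g where "g = \<gamma> z\<^sub>0"
    have g: "0 \<le> g" "g \<le> 1"
      using \<gamma> zB isCont_AE_le[OF cont zB AE\<gamma>1] by (auto simp: g_def bounded_measurable_nonneg_def)
    have r': "0 < r" "r < 1 / 2" "r < t\<^sub>0" "r < exp (- 2 * A)" using r by (auto simp: r\<^sub>0_def)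
    have CB: "cball z\<^sub>0 r \<subseteq> ?B"
      using z0 r' by (simp add: cball_subset_ball_iff)
    have "0 \<le> \<omega> 0" using modulus[OF zB] by simp
    then have w0: "0 \<le> \<omega> r" using mono_onD[OF mono, of 0 r] r' by simp
    have wA: "\<omega> r * ln (1 / r) \<le> A" using t\<^sub>0(2) r' by blast
    have "ln r < - 2 * A" using r' by (metis ln_exp ln_less_cancel_iff exp_gt_zero)
    then have "2 * A \<le> ln (1 / r)" using r' by (simp add: ln_div)
    then have "\<omega> r * (2 * A) \<le> A" using wA w0 mult_left_mono[of "2 * A" "ln (1 / r)" "\<omega> r"] by linarith
    then have w2: "\<omega> r \<le> 1 / 2" using A by (simp add: field_simps)
    show "c * r powr (2 / (2 - \<gamma> z\<^sub>0)) \<le> Sup (u ` sphere z\<^sub>0 r)"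
    proof (rule ccontr)
      assume "\<not> c * r powr (2 / (2 - \<gamma> z\<^sub>0)) \<le> Sup (u ` sphere z\<^sub>0 r)"
      define M where "M = Sup (u ` sphere z\<^sub>0 r)"
      have M: "M < c * r powr (2 / (2 - g))"
        using \<open>\<not> _ \<le> _\<close> by (simp add: M_def g_def)
      have SB: "x \<in> ?B" if "x \<in> sphere z\<^sub>0 r" for x
        using that CB sphere_cball by blast
      have uM: "u x \<le> M" if "x \<in> sphere z\<^sub>0 r" for x
        unfolding M_def using that u01(2) SB by (intro cSup_upper bdd_aboveI[of _ 1]) auto
      obtain p where p: "p \<in> sphere z\<^sub>0 r"
        using r' by (metis ex_in_conv less_eq_real_def sphere_eq_empty not_less)
      have M0: "0 \<le> M" using uM[OF p] u01(1)[OF SB[OF p]] by linarith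
      have M1: "M \<le> 1"
        unfolding M_def using p u01(2) SB by (intro cSup_least) auto
      \<comment> \<open>The constant \<open>M\<close> is the barrier with \<open>K = 0\<close>. Here
        \<open>\<kappa> = a\<close> works because \<open>u \<le> 1\<close> and
        \<open>\<gamma> \<le> 1\<close> make the power of \<open>u\<close> at least 1.\<close>
      have le_M: "u x \<le> M + 0 * (norm (x - z\<^sub>0))\<^sup>2" if "x \<in> ball z\<^sub>0 r" for x
      proof (rule minimizer_le_quadratic_barrier[OF min \<delta> \<gamma> AE01 CB _ M0 _ _ _ that])
        show "AE x in lebesgue_on ?B. x \<in> ball z\<^sub>0 r \<and> M + 0 * (norm (x - z\<^sub>0))\<^sup>2 < u x \<longrightarrow>
            a \<le> \<delta> x * \<gamma> x * u x powr (\<gamma> x - 1)"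
          using AE\<delta> AE\<gamma> AE\<gamma>1 AE_space
        proof (eventually_elim, intro impI)
          fix x assume b: "\<delta>\<^sub>0 \<le> \<delta> x" "\<gamma>\<^sub>0 \<le> \<gamma> x" "\<gamma> x \<le> 1" "x \<in> space (lebesgue_on ?B)"
            and x: "x \<in> ball z\<^sub>0 r \<and> M + 0 * (norm (x - z\<^sub>0))\<^sup>2 < u x"
          then have "0 < u x" "u x \<le> 1" using M0 u01(2)[of x] by auto
          then have "1 \<le> u x powr (\<gamma> x - 1)"
            using b powr_mono2'[of "\<gamma> x - 1" "u x" 1] by simp
          moreover have "a \<le> \<delta> x * \<gamma> x" unfolding a_def using b assms by (intro mult_mono) auto
          ultimately show "a \<le> \<delta> x * \<gamma> x * u x powr (\<gamma> x - 1)"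
            using a mult_mono[of a "\<delta> x * \<gamma> x" 1 "u x powr (\<gamma> x - 1)"] by simp
        qed
      qed (use uM a in auto)
      have "z\<^sub>0 \<in> closure (positivity_set u)"
        using fb by (simp add: free_boundary_def frontier_def)
      then obtain y where y: "y \<in> positivity_set u" "dist y z\<^sub>0 < r / 2"
        using r' by (metis closure_approachable half_gt_zero)
      then have uy: "0 < u y" by (simp add: positivity_set_def)
      have yr: "y \<in> ball z\<^sub>0 r" using y(2) r' by (simp add: dist_commute)
      have Mpos: "0 < M" using le_M[OF yr] uy by simp
      define \<kappa> where "\<kappa> = a * M powr (g - 1 + \<omega> r)"
      \<comment> \<open>The barrier is centred at a positivity point \<open>y\<close> within
        \<open>r / 2\<close> of \<open>z\<^sub>0\<close> and evaluated at its own centre, where it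
        vanishes. Points of the sphere are at least \<open>r / 2\<close> from \<open>y\<close>, so
        the factor 4 makes the barrier at least \<open>M\<close> there.\<close>
      have "u y \<le> 0 + 4 * M / r\<^sup>2 * (norm (y - y))\<^sup>2"
      proof (rule minimizer_le_quadratic_barrier[OF min \<delta> \<gamma> AE01 CB _ _ _ _ _ yr])
        show "2 * (4 * M / r\<^sup>2) * real CARD('n) < \<kappa>"
          unfolding \<kappa>_def n_def[symmetric]
          by (rule barrier_slope_less[OF Mpos M c sqc]) (use r' g w0 w2 wA a n in auto)
        show "u x \<le> 0 + 4 * M / r\<^sup>2 * (norm (x - y))\<^sup>2" if "x \<in> sphere z\<^sub>0 r" for x
        proof -
          have "r \<le> dist x y + dist y z\<^sub>0"
            using that dist_triangle[of x z\<^sub>0 y] by (simp add: dist_commute)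
          then have "r / 2 \<le> norm (x - y)" using y(2) by (simp add: dist_norm)
          then have "(r / 2)\<^sup>2 \<le> (norm (x - y))\<^sup>2" using r' by (intro power_mono) auto
          then have "4 * M / r\<^sup>2 * (r / 2)\<^sup>2 \<le> 4 * M / r\<^sup>2 * (norm (x - y))\<^sup>2"
            using Mpos by (intro mult_left_mono) auto
          then show ?thesis using uM[OF that] r' by (simp add: power_divide)
        qed
        show "AE x in lebesgue_on ?B. x \<in> ball z\<^sub>0 r \<and> 0 + 4 * M / r\<^sup>2 * (norm (x - y))\<^sup>2 < u x \<longrightarrow>
            \<kappa> \<le> \<delta> x * \<gamma> x * u x powr (\<gamma> x - 1)"
          using AE\<delta> AE\<gamma> AE\<gamma>1 AE_space
        proof (eventually_elim, intro impI)
          fix x assume b: "\<delta>\<^sub>0 \<le> \<delta> x" "\<gamma>\<^sub>0 \<le> \<gamma> x" "\<gamma> x \<le> 1" "x \<in> space (lebesgue_on ?B)"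
            and x: "x \<in> ball z\<^sub>0 r \<and> 0 + 4 * M / r\<^sup>2 * (norm (x - y))\<^sup>2 < u x"
          have "0 \<le> 4 * M / r\<^sup>2 * (norm (x - y))\<^sup>2" using Mpos by simp
          then have ux: "0 < u x" "u x \<le> M" using x le_M[of x] by auto
          have "\<omega> (norm (x - z\<^sub>0)) \<le> \<omega> r"
            by (rule mono_onD[OF mono]) (use x r' in \<open>auto simp: dist_norm norm_minus_commute\<close>)
          then have "\<gamma> x \<le> g + \<omega> r" using modulus[of x] b(4) by (simp add: g_def abs_le_iff)
          \<comment> \<open>Two monotonicities combine: as \<open>M \<le> 1\<close>, lowering the
            exponent raises the power; as \<open>\<gamma> x - 1 \<le> 0\<close>, lowering the base
            from \<open>M\<close> to \<open>u x\<close> raises it again.\<close>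
          then have "M powr (g - 1 + \<omega> r) \<le> M powr (\<gamma> x - 1)"
            using Mpos M1 by (intro powr_mono') auto
          also have "\<dots> \<le> u x powr (\<gamma> x - 1)"
            using ux b by (intro powr_mono2') auto
          finally have "M powr (g - 1 + \<omega> r) \<le> u x powr (\<gamma> x - 1)" .
          moreover have "a \<le> \<delta> x * \<gamma> x" unfolding a_def using b assms by (intro mult_mono) auto
          ultimately show "\<kappa> \<le> \<delta> x * \<gamma> x * u x powr (\<gamma> x - 1)"
            unfolding \<kappa>_def using a by (intro mult_mono) auto
        qed
      qed (use Mpos in auto)
      then show False using uy by simp
    qed
  qed
qed

end
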